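(* Let $n\in\mathbb{N}$, $k\geq 2$, $u\equiv a_{i_1}a_{i_2}\cdots a_{i_k}$ and $v\equiv a_{j_1}a_{j_2}\cdots a_{j_k}$ with all $a_{i_l},a_{j_l}\in\{a_1,\dots,a_n\}$, and let $S=sgp^+\langle a_1,\dots,a_n\mid u=v\rangle$, where $\{u=v\}$ is a Gröbner–Shirshov basis. If $S$ satisfies one of the following conditions, then $S$ is biautomatic and prefix-automatic: (1) for every $t\geq1$, $v(t)\not\equiv u[t]$ and $v[t]\not\equiv u(t)$; (2) $|con(u)|=k$; (3) $k=2$; (4) $con(u)\not\subseteq con(v)$; (5) $u\not\equiv ww'w$ and $v\not\equiv ss's$ for all $w,s\in\{a_1,\dots,a_n\}^+$ and $w',s'\in\{a_1,\dots,a_n\}^*$.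
   Context: $A^*$ is the free monoid (empty word $\varepsilon$), $A^+=A^*\setminus\{\varepsilon\}$, $\equiv$ denotes equality of words, $|w|$ length, $con(w)$ the set of letters occurring in $w$. $sgp^+\langle A\mid R\rangle$ is $A^+$ modulo the congruence generated by $R$. For $\alpha\equiv c_1\cdots c_k$ ($c_i\in A$) and $t\geq1$: $\alpha(t)$ is the prefix of length $t$ ($\alpha(t)\equiv\alpha$ if $t>k$) and $\alpha[t]$ is the suffix of length $t$ ($\alpha[t]\equiv\alpha$ if $t>k$). Gröbner–Shirshov bases: fix a well-ordering of $A$ and the deg-lex ordering on $A^*$ (length, then lexicographic); relations $u=v$ are written with $u>v$. For monic polynomials $f,g$ in the free associative algebra $F\langle A\rangle$ over a field with leading words $\bar f,\bar g$: if $w\equiv\bar f b\equiv a\bar g$ with $|\bar f|+|\bar g|>|w|$, $(f,g)_w=fb-ag$; if $w\equiv\bar f\equiv a\bar g b$, $(f,g)_w=f-agb$. It is trivial modulo $(R,w)$ if it equals $\sum\alpha_i a_i s_i b_i$ with $\alpha_i\in F$, $s_i\in R$, $a_i\bar{s_i}b_i<w$. $R$ is a Gröbner–Shirshov basis if all compositions are trivial; a set of relations $\{u=v\}$ is one if $\{u-v\}$ is. Automaticity: regular = accepted by a finite automaton. With $\$\notin A$, $A(2,\$)=(A\cup\{\$\})^2\setminus\{(\$,\$)\}$; $(\alpha,\beta)\delta_A^R$ (resp. $\delta_A^L$) is the word over $A(2,\$)$ obtained by padding the shorter word on the right (resp. left) with $\$$'s and reading letter pairs. For $S$ generated by finite $A$,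 $\phi:A^+\to S$ canonical, $L\subseteq A^+$ regular with $\phi(L)=S$, write $\alpha=\beta$ if $\phi(\alpha)=\phi(\beta)$, and for $a\in A\cup\{\varepsilon\}$: $L_a^\$=\{(\alpha,\beta)\delta^R_A:\alpha a=\beta\}$, ${}^\$L_a=\{(\alpha,\beta)\delta^L_A:\alpha a=\beta\}$, ${}_aL^\$=\{(\alpha,\beta)\delta^R_A:a\alpha=\beta\}$, ${}^\$_aL=\{(\alpha,\beta)\delta^L_A:a\alpha=\beta\}$ (with $\alpha,\beta\in L$). $S$ is automatic if some such $(A,L)$ has all $L_a^\$$ regular; biautomatic if some $(A,L)$ has all four families regular; prefix-automatic if some automatic structure $(A,L)$ also has $\{(\alpha,\beta)\delta_A^R:\alpha\in L,\beta\in\mathrm{Pref}(L),\alpha=\beta\}$ regular. *)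

theory Defs
  imports Main
begin

text \<open>Words over the base alphabet a_1,...,a_n are lists of naturals below n
  (letter a_i is encoded as i-1).  The deg-lex ordering is lenlex less_than.\<close>

definition deglex_less :: "nat list \<Rightarrow> nat list \<Rightarrow> bool" where
  "deglex_less x y \<longleftrightarrow> (x, y) \<in> lenlex less_than"

definition rstep :: "(nat list \<times> nat list) set \<Rightarrow> (nat list \<times> nat list) set" where
  "rstep R = {(x @ l @ y, x @ r @ y) | x y l r. (l, r) \<in> R}"

definition sgp_eq :: "(nat list \<times> nat list) set \<Rightarrow> nat list \<Rightarrow> nat list \<Rightarrow> bool" where
  "sgp_eq R x y \<longleftrightarrow> (x, y) \<in> (rstep R \<union> (rstep R)\<inverse>)\<^sup>*"

type_synonym 'k ncpoly = "nat list \<Rightarrow> 'k"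

definition is_ncpoly :: "'k::zero ncpoly \<Rightarrow> bool" where
  "is_ncpoly f \<longleftrightarrow> finite {w. f w \<noteq> 0}"

definition lw :: "'k::zero ncpoly \<Rightarrow> nat list" where
  "lw f = (THE w. f w \<noteq> 0 \<and> (\<forall>w'. f w' \<noteq> 0 \<longrightarrow> w' = w \<or> deglex_less w' w))"

definition pmult :: "nat list \<Rightarrow> 'k::zero ncpoly \<Rightarrow> nat list \<Rightarrow> 'k ncpoly" where
  "pmult a f b = (\<lambda>w. if (\<exists>x. w = a @ x @ b) then f (drop (length a) (take (length w - length b) w)) else 0)"

definition rel_poly :: "nat list \<Rightarrow> nat list \<Rightarrow> 'k::ring_1 ncpoly" where
  "rel_poly u v = (\<lambda>x. (if x = u then 1 else 0) - (if x = v then 1 else 0))"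

definition comp_trivial :: "'k::field ncpoly set \<Rightarrow> 'k ncpoly \<Rightarrow> nat list \<Rightarrow> bool" where
  "comp_trivial R h w \<longleftrightarrow>
     (\<exists>c :: nat list \<times> 'k ncpoly \<times> nat list \<Rightarrow> 'k.
        finite {t. c t \<noteq> 0} \<and>
        (\<forall>a s b. c (a, s, b) \<noteq> 0 \<longrightarrow> s \<in> R \<and> deglex_less (a @ lw s @ b) w) \<and>
        h = (\<lambda>x. \<Sum>t\<in>{t. c t \<noteq> 0}. c t * pmult (fst t) (fst (snd t)) (snd (snd t)) x))"

definition GS_basis :: "'k::field ncpoly set \<Rightarrow> bool" where
  "GS_basis R \<longleftrightarrow>
    (\<forall>f\<in>R. \<forall>g\<in>R.
      (\<forall>a b w. w = lw f @ b \<and> w = a @ lw g \<and> length (lw f) + length (lw g) > length w \<longrightarrow>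
          comp_trivial R (\<lambda>x. pmult [] f b x - pmult a g [] x) w) \<and>
      (\<forall>a b. lw f = a @ lw g @ b \<longrightarrow>
          comp_trivial R (\<lambda>x. f x - pmult a g b x) (lw f)))"

definition regular :: "'a set \<Rightarrow> 'a list set \<Rightarrow> bool" where
  "regular \<Sigma> L \<longleftrightarrow> L \<subseteq> lists \<Sigma> \<and>
     (\<exists>(Q :: nat set) q0 (\<delta> :: nat \<Rightarrow> 'a \<Rightarrow> nat) F.
        finite Q \<and> q0 \<in> Q \<and> F \<subseteq> Q \<and> (\<forall>q\<in>Q. \<forall>x\<in>\<Sigma>. \<delta> q x \<in> Q) \<and>
        L = {w \<in> lists \<Sigma>. foldl \<delta> q0 w \<in> F})"

text \<open>None plays the role of the padding symbol dollar.\<close>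
definition A2 :: "'a set \<Rightarrow> ('a option \<times> 'a option) set" where
  "A2 A = (insert None (Some ` A) \<times> insert None (Some ` A)) - {(None, None)}"

definition padR :: "'a list \<Rightarrow> 'a list \<Rightarrow> ('a option \<times> 'a option) list" where
  "padR \<alpha> \<beta> = zip (map Some \<alpha> @ replicate (length \<beta> - length \<alpha>) None)
                    (map Some \<beta> @ replicate (length \<alpha> - length \<beta>) None)"

definition padL :: "'a list \<Rightarrow> 'a list \<Rightarrow> ('a option \<times> 'a option) list" where
  "padL \<alpha> \<beta> = zip (replicate (length \<beta> - length \<alpha>) None @ map Some \<alpha>)
                    (replicate (length \<alpha> - length \<beta>) None @ map Some \<beta>)"

text \<open>A finite generating alphabet A with canonical map: letter x of A denotes the element
  of S represented by the nonempty base word g x.\<close>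
definition phi :: "(nat \<Rightarrow> nat list) \<Rightarrow> nat list \<Rightarrow> nat list" where
  "phi g \<alpha> = concat (map g \<alpha>)"

definition EQ :: "(nat list \<times> nat list) set \<Rightarrow> (nat \<Rightarrow> nat list) \<Rightarrow> nat list \<Rightarrow> nat list \<Rightarrow> bool" where
  "EQ R g \<alpha> \<beta> \<longleftrightarrow> sgp_eq R (phi g \<alpha>) (phi g \<beta>)"

definition lang_str :: "nat \<Rightarrow> (nat list \<times> nat list) set \<Rightarrow> nat set \<Rightarrow> (nat \<Rightarrow> nat list) \<Rightarrow> nat list set \<Rightarrow> bool" where
  "lang_str n R A g L \<longleftrightarrow>
     finite A \<and> (\<forall>x\<in>A. g x \<noteq> [] \<and> set (g x) \<subseteq> {..<n}) \<and>
     L \<subseteq> lists A \<and> [] \<notin> L \<and> regular A L \<and>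
     (\<forall>w. w \<noteq> [] \<and> set w \<subseteq> {..<n} \<longrightarrow> (\<exists>\<alpha>\<in>L. sgp_eq R (phi g \<alpha>) w))"

definition letters_eps :: "nat set \<Rightarrow> nat list set" where
  "letters_eps A = insert [] ((\<lambda>x. [x]) ` A)"

definition LR_right :: "(nat list \<times> nat list) set \<Rightarrow> (nat \<Rightarrow> nat list) \<Rightarrow> nat list set \<Rightarrow> nat list \<Rightarrow> (nat option \<times> nat option) list set" where
  "LR_right R g L a = {padR \<alpha> \<beta> | \<alpha> \<beta>. \<alpha> \<in> L \<and> \<beta> \<in> L \<and> EQ R g (\<alpha> @ a) \<beta>}"
definition LL_right :: "(nat list \<times> nat list) set \<Rightarrow> (nat \<Rightarrow> nat list) \<Rightarrow> nat list set \<Rightarrow> nat list \<Rightarrow> (nat option \<times> nat option) list set" where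
  "LL_right R g L a = {padL \<alpha> \<beta> | \<alpha> \<beta>. \<alpha> \<in> L \<and> \<beta> \<in> L \<and> EQ R g (\<alpha> @ a) \<beta>}"
definition LR_left :: "(nat list \<times> nat list) set \<Rightarrow> (nat \<Rightarrow> nat list) \<Rightarrow> nat list set \<Rightarrow> nat list \<Rightarrow> (nat option \<times> nat option) list set" where
  "LR_left R g L a = {padR \<alpha> \<beta> | \<alpha> \<beta>. \<alpha> \<in> L \<and> \<beta> \<in> L \<and> EQ R g (a @ \<alpha>) \<beta>}"
definition LL_left :: "(nat list \<times> nat list) set \<Rightarrow> (nat \<Rightarrow> nat list) \<Rightarrow> nat list set \<Rightarrow> nat list \<Rightarrow> (nat option \<times> nat option) list set" where
  "LL_left R g L a = {padL \<alpha> \<beta> | \<alpha> \<beta>. \<alpha> \<in> L \<and> \<beta> \<in> L \<and> EQ R g (a @ \<alpha>) \<beta>}"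

definition automatic_str :: "nat \<Rightarrow> (nat list \<times> nat list) set \<Rightarrow> nat set \<Rightarrow> (nat \<Rightarrow> nat list) \<Rightarrow> nat list set \<Rightarrow> bool" where
  "automatic_str n R A g L \<longleftrightarrow> lang_str n R A g L \<and>
     (\<forall>a\<in>letters_eps A. regular (A2 A) (LR_right R g L a))"

definition biautomatic :: "nat \<Rightarrow> (nat list \<times> nat list) set \<Rightarrow> bool" where
  "biautomatic n R \<longleftrightarrow> (\<exists>A g L. lang_str n R A g L \<and>
     (\<forall>a\<in>letters_eps A. regular (A2 A) (LR_right R g L a) \<and> regular (A2 A) (LL_right R g L a) \<and>
                         regular (A2 A) (LR_left R g L a) \<and> regular (A2 A) (LL_left R g L a)))"

definition prefix_automatic :: "nat \<Rightarrow> (nat list \<times> nat list) set \<Rightarrow> bool" where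
  "prefix_automatic n R \<longleftrightarrow> (\<exists>A g L. automatic_str n R A g L \<and>
     regular (A2 A) {padR \<alpha> \<beta> | \<alpha> \<beta>. \<alpha> \<in> L \<and> \<beta> \<noteq> [] \<and> (\<exists>\<gamma>. \<beta> @ \<gamma> \<in> L) \<and> EQ R g \<alpha> \<beta>})"

end

theory Submission
  imports Defs
begin

text \<open>Since \<open>{u = v}\<close> is a Groebner-Shirshov basis, every element has a unique normal form, namely a word
  without factor \<open>u\<close>; let \<open>L\<close> be the set of nonempty normal forms. It is closed under
  factors, so prefix-automaticity is the regularity of the diagonal of \<open>L\<close>.

  Let \<open>\<alpha>\<close> be a normal form with \<open>\<alpha> a = \<gamma> u\<close>. Replacing \<open>u\<close> by \<open>v\<close> can create an occurrence of \<open>u\<close>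
  that straddles \<open>\<gamma>\<close> and \<open>v\<close>: then \<open>u = p s\<close>, \<open>v = s q\<close> and \<open>\<gamma> = \<gamma>' p\<close>, and the next word is \<open>\<gamma>' v q\<close>.
  Each of the conditions implies that no occurrence is ever created to the right of such a block
  \<open>v\<close>, so the normal form of \<open>\<gamma> p\<^sub>m \<dots> p\<^sub>1 u\<close> is \<open>\<gamma> v q\<^sub>m \<dots> q\<^sub>1\<close> where \<open>p\<^sub>i\<close> and \<open>q\<^sub>i\<close> have equal lengths. Up to a
  shift of one track by the length of \<open>v\<close>, these pairs form a rational expression over finitely many
  words, hence a regular language. The conditions are invariant under reversal, which gives
  multiplication on the left.\<close>

section \<open>Languages with finitely many left quotients\<close>

definition lquot :: "'a list \<Rightarrow> 'a list set \<Rightarrow> 'a list set" where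
  "lquot w L = {z. w @ z \<in> L}"

definition quots :: "'a list set \<Rightarrow> 'a list set set" where
  "quots L = range (\<lambda>w. lquot w L)"

text \<open>Myhill-Nerode form of regularity. It mentions neither alphabet nor states, so the
  closure properties below are statements about finite families of languages.\<close>

definition fin_index :: "'a list set \<Rightarrow> bool" where
  "fin_index L \<longleftrightarrow> finite (quots L)"

definition lconc :: "'a list set \<Rightarrow> 'a list set \<Rightarrow> 'a list set" where
  "lconc L M = {x @ y | x y. x \<in> L \<and> y \<in> M}"

inductive_set lstar :: "'a list set \<Rightarrow> 'a list set" for L where
  lstar_Nil: "[] \<in> lstar L"
| lstar_append: "x \<in> L \<Longrightarrow> y \<in> lstar L \<Longrightarrow> x @ y \<in> lstar L"

lemma lquot_Nil [simp]: "lquot [] L = L"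
  by (simp add: lquot_def)

lemma lquot_append: "lquot (v @ w) L = lquot w (lquot v L)"
  by (simp add: lquot_def)

text \<open>A quotient by a word is an iterated quotient by letters, so \<open>B\<close> contains
  all quotients of \<open>L\<close>.\<close>

lemma fin_index_closed_family:
  assumes "finite B" "L \<in> B" "\<And>K c. K \<in> B \<Longrightarrow> lquot [c] K \<in> B"
  shows "fin_index L"
proof -
  have "lquot w K \<in> B" if "K \<in> B" for w K
    using that
  proof (induction w arbitrary: K)
    case (Cons c w)
    then show ?case
      using assms(3)[of K c] lquot_append[of "[c]" w K] by simp
  qed simp
  then have "quots L \<subseteq> B" using assms(2) by (auto simp: quots_def)
  then show ?thesis unfolding fin_index_def using assms(1) finite_subset by blast
qed

text \<open>Subset construction: the members of \<open>B\<close> act as states of a nondeterministic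
  automaton, and the unions of subfamilies of \<open>B\<close> form a finite family closed under
  one-letter quotients.\<close>

lemma fin_index_union_family:
  assumes "finite B" "L \<in> B" "\<And>K c. K \<in> B \<Longrightarrow> \<exists>X\<subseteq>B. lquot [c] K = \<Union>X"
  shows "fin_index L"
proof (rule fin_index_closed_family)
  show "finite (Union ` Pow B)" using assms(1) by simp
  show "L \<in> Union ` Pow B" using assms(2) by (intro image_eqI[of _ _ "{L}"]) auto
  fix M c assume "M \<in> Union ` Pow B"
  then obtain Y where Y: "Y \<subseteq> B" "M = \<Union>Y" by auto
  from assms(3) obtain X where X: "\<And>K c. K \<in> B \<Longrightarrow> X K c \<subseteq> B \<and> lquot [c] K = \<Union>(X K c)"
    by metis
  have "lquot [c] M = (\<Union>K\<in>Y. lquot [c] K)" using Y by (auto simp: lquot_def)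
  also have "\<dots> = (\<Union>K\<in>Y. \<Union>(X K c))" using X Y(1) by (intro SUP_cong) (simp_all add: subset_iff)
  also have "\<dots> = \<Union>(\<Union>K\<in>Y. X K c)" by blast
  finally have "lquot [c] M = \<Union>(\<Union>K\<in>Y. X K c)" .
  moreover have "(\<Union>K\<in>Y. X K c) \<subseteq> B" using X Y by (meson UN_least subsetD)
  ultimately show "lquot [c] M \<in> Union ` Pow B" by (metis PowI imageI)
qed

lemma lquot_in_quots: "K \<in> quots L \<Longrightarrow> lquot v K \<in> quots L"
  by (auto simp: quots_def simp flip: lquot_append)

lemma self_in_quots: "L \<in> quots L"
  unfolding quots_def by (metis lquot_Nil rangeI)

lemma lquot_self_in_quots [simp]: "lquot v L \<in> quots L"
  by (rule lquot_in_quots[OF self_in_quots])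

lemma fin_index_UNIV [simp]: "fin_index UNIV"
  by (rule fin_index_closed_family[of "{UNIV}"]) (auto simp: lquot_def)

lemma fin_index_lists [simp]: "fin_index (lists A)"
  by (rule fin_index_closed_family[of "{lists A, {}}"]) (auto simp: lquot_def)

lemma fin_index_letters [simp]: "fin_index ((\<lambda>x. [x]) ` A)"
  by (rule fin_index_closed_family[of "{(\<lambda>x. [x]) ` A, {[]}, {}}"]) (auto simp: lquot_def)

lemma fin_index_Compl:
  assumes "fin_index L" shows "fin_index (- L)"
proof (rule fin_index_closed_family)
  show "finite (uminus ` quots L)"
    using assms unfolding fin_index_def by (rule finite_imageI)
  show "- L \<in> uminus ` quots L" using self_in_quots by blast
  fix K c assume "K \<in> uminus ` quots L"
  then obtain M where M: "M \<in> quots L" "K = - M" by blast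
  have "lquot [c] K = - lquot [c] M" using M(2) by (auto simp: lquot_def)
  then show "lquot [c] K \<in> uminus ` quots L" using lquot_in_quots[OF M(1)] by blast
qed

lemma fin_index_Un:
  assumes "fin_index L" "fin_index M" shows "fin_index (L \<union> M)"
proof (rule fin_index_union_family)
  let ?B = "insert (L \<union> M) (quots L \<union> quots M)"
  show "finite ?B" using assms by (simp add: fin_index_def)
  show "L \<union> M \<in> ?B" by blast
  fix K c assume "K \<in> ?B"
  then consider "K = L \<union> M" | "K \<in> quots L" | "K \<in> quots M" by blast
  then show "\<exists>X\<subseteq>?B. lquot [c] K = \<Union>X"
  proof cases
    case 1
    have "lquot [c] K = \<Union>{lquot [c] L, lquot [c] M}" using 1 by (auto simp: lquot_def)
    then show ?thesis by (intro exI[of _ "{lquot [c] L, lquot [c] M}"]) auto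
  qed (intro exI[of _ "{lquot [c] K}"]; use lquot_in_quots in fastforce)+
qed

lemma fin_index_Int:
  assumes "fin_index L" "fin_index M" shows "fin_index (L \<inter> M)"
proof -
  have "fin_index (- (- L \<union> - M))" using assms by (intro fin_index_Compl fin_index_Un)
  then show ?thesis by simp
qed

lemma fin_index_singleton: "fin_index {w}"
proof (rule fin_index_closed_family)
  let ?B = "insert {} ((\<lambda>i. {drop i w}) ` {..length w})"
  show "finite ?B" by simp
  show "{w} \<in> ?B" by (intro insertI2 image_eqI[of _ _ 0]) auto
  fix K c assume "K \<in> ?B"
  then consider "K = {}" | i where "i \<le> length w" "K = {drop i w}" by blast
  then show "lquot [c] K \<in> ?B"
  proof cases
    case 1 then show ?thesis by (simp add: lquot_def)
  next
    case 2
    show ?thesis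
    proof (cases "i < length w \<and> w ! i = c")
      case True
      then have "drop i w = c # drop (Suc i) w" by (metis Cons_nth_drop_Suc)
      then have "lquot [c] K = {drop (Suc i) w}" using 2 by (simp add: lquot_def)
      then show ?thesis using True by (intro insertI2 image_eqI[of _ _ "Suc i"]) auto
    next
      case False
      then have "\<And>z. c # z \<noteq> drop i w" by (metis Cons_nth_drop_Suc drop_all leI list.inject list.simps(3))
      then have "lquot [c] K = {}" using 2 by (simp add: lquot_def)
      then show ?thesis by blast
    qed
  qed
qed

lemma fin_index_finite: "finite L \<Longrightarrow> fin_index L"
proof (induction L rule: finite_induct)
  case empty
  show ?case by (rule fin_index_closed_family[of "{{}}"]) (auto simp: lquot_def)
next
  case (insert w L)
  then show ?case using fin_index_Un[OF fin_index_singleton[of w]] by (metis insert_is_Un)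
qed

text \<open>Brzozowski derivative of a product: the letter is taken from the first factor unless
  that factor is the empty word.\<close>

lemma lquot_lconc: "lquot [c] (lconc K M) = lconc (lquot [c] K) M \<union> (if [] \<in> K then lquot [c] M else {})"
proof (intro set_eqI iffI)
  fix z assume "z \<in> lquot [c] (lconc K M)"
  then obtain x y where xy: "c # z = x @ y" "x \<in> K" "y \<in> M" by (auto simp: lquot_def lconc_def)
  then show "z \<in> lconc (lquot [c] K) M \<union> (if [] \<in> K then lquot [c] M else {})"
    by (cases x) (auto simp: lquot_def lconc_def)
qed (auto simp: lquot_def lconc_def split: if_splits; metis append_Cons append_Nil)

lemma fin_index_lconc:
  assumes "fin_index L" "fin_index M" shows "fin_index (lconc L M)"
proof (rule fin_index_union_family)
  let ?B = "(\<lambda>K. lconc K M) ` quots L \<union> quots M"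
  show "finite ?B" using assms by (simp add: fin_index_def)
  show "lconc L M \<in> ?B" using self_in_quots by blast
  fix N c assume "N \<in> ?B"
  then consider K where "N = lconc K M" "K \<in> quots L" | "N \<in> quots M" by blast
  then show "\<exists>X\<subseteq>?B. lquot [c] N = \<Union>X"
  proof cases
    case 1
    let ?X = "insert (lconc (lquot [c] K) M) (if [] \<in> K then {lquot [c] M} else {})"
    have "?X \<subseteq> ?B" using lquot_in_quots[OF 1(2)] by auto
    moreover have "lquot [c] N = \<Union>?X" using 1(1) by (simp add: lquot_lconc)
    ultimately show ?thesis by blast
  next
    case 2
    then show ?thesis using lquot_in_quots by (intro exI[of _ "{lquot [c] N}"]) fastforce
  qed
qed

lemma lquot_lstar: "lquot [c] (lstar L) = lconc (lquot [c] L) (lstar L)"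
proof (intro set_eqI iffI)
  fix z assume "z \<in> lquot [c] (lstar L)"
  then have "c # z \<in> lstar L" by (simp add: lquot_def)
  then show "z \<in> lconc (lquot [c] L) (lstar L)"
  proof (induction "c # z" arbitrary: z rule: lstar.induct)
    case (lstar_append x y)
    then show ?case by (cases x) (auto simp: lconc_def lquot_def)
  qed
next
  fix z assume "z \<in> lconc (lquot [c] L) (lstar L)"
  then obtain x y where "z = x @ y" "c # x \<in> L" "y \<in> lstar L" by (auto simp: lconc_def lquot_def)
  then show "z \<in> lquot [c] (lstar L)" using lstar.lstar_append[of "c # x" L y] by (simp add: lquot_def)
qed

lemma fin_index_lstar:
  assumes "fin_index L" shows "fin_index (lstar L)"
proof (rule fin_index_union_family)
  let ?B = "insert (lstar L) ((\<lambda>K. lconc K (lstar L)) ` quots L)"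
  show "finite ?B" using assms by (simp add: fin_index_def)
  show "lstar L \<in> ?B" by blast
  fix N c assume "N \<in> ?B"
  then consider "N = lstar L" | K where "N = lconc K (lstar L)" "K \<in> quots L" by blast
  then show "\<exists>X\<subseteq>?B. lquot [c] N = \<Union>X"
  proof cases
    case 1
    then show ?thesis by (intro exI[of _ "{lconc (lquot [c] L) (lstar L)}"]) (auto simp: lquot_lstar)
  next
    case 2
    let ?X = "insert (lconc (lquot [c] K) (lstar L)) (if [] \<in> K then {lconc (lquot [c] L) (lstar L)} else {})"
    have "?X \<subseteq> ?B" using lquot_in_quots[OF 2(2)] by auto
    moreover have "lquot [c] N = \<Union>?X" using 2(1) by (simp add: lquot_lconc lquot_lstar)
    ultimately show ?thesis by blast
  qed
qed

text \<open>Guessing the preimage \<open>d\<close> of a letter \<open>c\<close> is nondeterministic,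
  hence the union over all \<open>d\<close> with \<open>h d = c\<close>.\<close>

lemma fin_index_map_image:
  assumes "fin_index L" shows "fin_index (map h ` L)"
proof (rule fin_index_union_family)
  let ?B = "(\<lambda>K. map h ` K) ` quots L"
  show "finite ?B" using assms by (simp add: fin_index_def)
  show "map h ` L \<in> ?B" using self_in_quots by blast
  fix N c assume "N \<in> ?B"
  then obtain K where K: "N = map h ` K" "K \<in> quots L" by blast
  let ?X = "{map h ` lquot [d] K | d. h d = c}"
  have "?X \<subseteq> ?B" using lquot_in_quots[OF K(2)] by blast
  moreover have "lquot [c] N = \<Union>?X"
  proof (intro set_eqI iffI)
    fix z assume "z \<in> lquot [c] N"
    then obtain d w' where "h d = c" "z = map h w'" "d # w' \<in> K" by (auto simp: K(1) lquot_def)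
    then show "z \<in> \<Union>?X" by (auto simp: lquot_def)
  next
    fix z assume "z \<in> \<Union>?X"
    then obtain d w' where "h d = c" "z = map h w'" "d # w' \<in> K" by (auto simp: lquot_def)
    then have "c # z = map h (d # w')" "d # w' \<in> K" by simp_all
    then have "c # z \<in> map h ` K" by (rule image_eqI)
    then show "z \<in> lquot [c] N" by (simp add: K(1) lquot_def)
  qed
  ultimately show "\<exists>X\<subseteq>?B. lquot [c] N = \<Union>X" by blast
qed

lemma fin_index_map_vimage:
  assumes "fin_index L" shows "fin_index {w. map h w \<in> L}"
proof (rule fin_index_closed_family)
  let ?B = "(\<lambda>K. {w. map h w \<in> K}) ` quots L"
  show "finite ?B" using assms by (simp add: fin_index_def)
  show "{w. map h w \<in> L} \<in> ?B" using self_in_quots by blast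
  fix N c assume "N \<in> ?B"
  then obtain K where K: "N = {w. map h w \<in> K}" "K \<in> quots L" by blast
  have "lquot [c] N = {w. map h w \<in> lquot [h c] K}" by (simp add: K(1) lquot_def)
  then show "lquot [c] N \<in> ?B" using lquot_in_quots[OF K(2)] by blast
qed

text \<open>A left quotient of the reversed language by \<open>w\<close> is determined by which of the finitely many
  left quotients of the language contain the reversal of \<open>w\<close>.\<close>

lemma fin_index_rev:
  assumes "fin_index L" shows "fin_index (rev ` L)"
proof -
  let ?Q = "quots L"
  let ?F = "\<lambda>X. {z. lquot (rev z) L \<in> X}"
  have "lquot w (rev ` L) \<in> ?F ` Pow ?Q" for w
  proof (rule image_eqI)
    have "w @ z \<in> rev ` L \<longleftrightarrow> rev z @ rev w \<in> L" for z
      by (metis image_iff rev_append rev_rev_ident)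
    then show "lquot w (rev ` L) = ?F {K \<in> ?Q. rev w \<in> K}" by (auto simp: lquot_def quots_def)
    show "{K \<in> ?Q. rev w \<in> K} \<in> Pow ?Q" by blast
  qed
  then have "quots (rev ` L) \<subseteq> ?F ` Pow ?Q" unfolding quots_def by (rule image_subsetI)
  moreover have "finite (?F ` Pow ?Q)" using assms by (simp add: fin_index_def)
  ultimately show ?thesis unfolding fin_index_def by (rule finite_subset)
qed

text \<open>Delaying the first of two synchronous tracks by one position costs a buffer of one letter.\<close>

lemma fin_index_delay:
  fixes Z :: "('a \<times> 'b) list set"
  assumes "fin_index Z" "finite S" "Z \<subseteq> lists (UNIV \<times> S)"
  shows "fin_index {zip (c # X) Y | X Y. length Y = Suc (length X) \<and> zip (X @ [d]) Y \<in> Z}" (is "fin_index ?D")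
proof (rule fin_index_closed_family)
  \<comment> \<open>The buffered letter \<open>y\<close> of the second track waits for its partner,
    which arrives with the next pair. \<open>K\<close> is the quotient of \<open>Z\<close> by the
    pairs completed so far; the last partner is \<open>d\<close>.\<close>
  define G where "G K y = {V. zip (map fst V @ [d]) (y # map snd V) \<in> K}" for K :: "('a \<times> 'b) list set" and y
  let ?Q = "quots Z"
  let ?B = "{?D, {}} \<union> case_prod G ` (?Q \<times> S)"
  show "finite ?B" using assms(1,2) by (simp add: fin_index_def)
  show "?D \<in> ?B" by blast
  \<comment> \<open>Buffering a letter outside \<open>S\<close> leaves the empty language, so the
    family stays finite.\<close>
  have GB: "G K y \<in> ?B" if "K \<in> ?Q" for K y
  proof (cases "y \<in> S")
    case True then show ?thesis using that by auto
  next
    case False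
    obtain w where w: "K = lquot w Z" using \<open>K \<in> ?Q\<close> by (auto simp: quots_def)
    have "G K y = {}"
    proof (rule ccontr)
      assume "G K y \<noteq> {}"
      then obtain V where "w @ zip (map fst V @ [d]) (y # map snd V) \<in> Z"
        by (auto simp: G_def w lquot_def)
      then have "zip (map fst V @ [d]) (y # map snd V) \<in> lists (UNIV \<times> S)"
        using assms(3) by (meson append_in_lists_conv subsetD)
      moreover obtain x X where "map fst V @ [d] = x # X" by (metis append_is_Nil_conv list.exhaust not_Cons_self)
      ultimately show False using False by auto
    qed
    then show ?thesis by simp
  qed
  fix N e assume "N \<in> ?B"
  then consider "N = {}" | "N = ?D" | K y where "K \<in> ?Q" "N = G K y"
    by (elim UnE insertE imageE SigmaE) (blast | simp only: prod.case)+
  then show "lquot [e] N \<in> ?B"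
  proof cases
    case 1 then show ?thesis by (simp add: lquot_def)
  next
    case 2
    obtain x y where e: "e = (x, y)" by (cases e)
    show ?thesis
    proof (cases "x = c")
      case True
      have "lquot [e] N = G Z y"
      proof (intro set_eqI iffI)
        fix V assume "V \<in> lquot [e] N"
        then obtain X Y where "e # V = zip (c # X) Y" "length Y = Suc (length X)" "zip (X @ [d]) Y \<in> Z"
          using 2 by (auto simp: lquot_def)
        moreover then obtain y' Y' where "Y = y' # Y'" by (cases Y) auto
        ultimately show "V \<in> G Z y" using e by (auto simp: G_def)
      next
        fix V assume "V \<in> G Z y"
        then have "e # V = zip (c # map fst V) (y # map snd V) \<and> length (y # map snd V) = Suc (length (map fst V))
             \<and> zip (map fst V @ [d]) (y # map snd V) \<in> Z"
          using e True by (simp add: G_def zip_map_fst_snd)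
        then have "e # V \<in> ?D" by blast
        then show "V \<in> lquot [e] N" by (simp add: 2 lquot_def)
      qed
      then show ?thesis by (simp only: GB[OF self_in_quots])
    next
      case False
      have "lquot [e] N = {}"
        using 2 False e by (auto simp: lquot_def zip_Cons1 split: list.splits)
      then show ?thesis by simp
    qed
  next
    case 3
    \<comment> \<open>The arriving pair \<open>e\<close> completes the buffered letter with
      \<open>fst e\<close> and leaves \<open>snd e\<close> in the buffer.\<close>
    have "lquot [e] N = G (lquot [(fst e, y)] K) (snd e)" by (simp add: 3 G_def lquot_def)
    then show ?thesis by (simp only: GB[OF lquot_in_quots[OF 3(1)]])
  qed
qed

text \<open>The quotients are the states, numbered because \<open>regular\<close> asks for natural
  numbers; a state is final if it contains the empty word.\<close>

lemma regular_if_fin_index: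
  assumes "fin_index L" "L \<subseteq> lists \<Sigma>"
  shows "regular \<Sigma> L"
proof -
  let ?Q = "quots L"
  obtain f :: "'a list set \<Rightarrow> nat" where f: "inj_on f ?Q"
    using assms(1) unfolding fin_index_def by (metis finite_imp_inj_to_nat_seg)
  define \<delta> where "\<delta> q x = f (lquot [x] (inv_into ?Q f q))" for q x
  have step: "\<delta> (f K) x = f (lquot [x] K)" if "K \<in> ?Q" for K x
    using that f by (simp add: \<delta>_def)
  have run: "foldl \<delta> (f K) w = f (lquot w K)" if "K \<in> ?Q" for K w
    using that
  proof (induction w arbitrary: K)
    case (Cons x w)
    have "foldl \<delta> (f (lquot [x] K)) w = f (lquot w (lquot [x] K))"
      by (rule Cons.IH[OF lquot_in_quots[OF Cons.prems]])
    then show ?case using step[OF Cons.prems] lquot_append[of "[x]" w K] by simp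
  qed simp
  let ?F = "f ` {K \<in> ?Q. [] \<in> K}"
  have acc: "foldl \<delta> (f L) w \<in> ?F \<longleftrightarrow> w \<in> L" for w
  proof -
    have "f (lquot w L) \<in> ?F \<longleftrightarrow> [] \<in> lquot w L"
      using f by (auto simp: inj_on_def)
    then show ?thesis using run[OF self_in_quots, of w] by (simp add: lquot_def)
  qed
  have "finite (f ` ?Q)" using assms(1) by (simp add: fin_index_def)
  moreover have "f L \<in> f ` ?Q" using self_in_quots by blast
  moreover have "?F \<subseteq> f ` ?Q" by blast
  moreover have "\<forall>q\<in>f ` ?Q. \<forall>x\<in>\<Sigma>. \<delta> q x \<in> f ` ?Q" using step lquot_in_quots by fastforce
  moreover have "L = {w \<in> lists \<Sigma>. foldl \<delta> (f L) w \<in> ?F}" using acc assms(2) by blast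
  ultimately show ?thesis unfolding regular_def using assms(2) by blast
qed

section \<open>Unique normal forms\<close>

definition avoids :: "'a list \<Rightarrow> 'a list \<Rightarrow> bool" where
  "avoids u w \<longleftrightarrow> (\<nexists>x y. w = x @ u @ y)"

text \<open>The consequence of the Groebner-Shirshov property on which the study of multiplication
  rests. No ordering occurs in it, so it survives reversal of the rule, where \<open>rev v\<close>
  may exceed \<open>rev u\<close>.\<close>

definition unique_nf :: "nat list \<Rightarrow> nat list \<Rightarrow> bool" where
  "unique_nf u v \<longleftrightarrow> (\<forall>x y. avoids u x \<and> avoids u y \<and> sgp_eq {(u, v)} x y \<longrightarrow> x = y)"

lemma avoids_factor: "avoids u (x @ w @ y) \<Longrightarrow> avoids u w"
  unfolding avoids_def by (metis append.assoc)

lemma rstep_single: "rstep {(u, v)} = {(x @ u @ y, x @ v @ y) | x y. True}"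
  by (auto simp: rstep_def)

lemma sgp_eq_step: "sgp_eq {(u, v)} (x @ u @ y) (x @ v @ y)"
  unfolding sgp_eq_def by (intro r_into_rtrancl) (auto simp: rstep_single)

lemma sgp_eq_refl: "sgp_eq R x x"
  by (simp add: sgp_eq_def)

lemma sgp_eq_trans: "sgp_eq R x y \<Longrightarrow> sgp_eq R y z \<Longrightarrow> sgp_eq R x z"
  unfolding sgp_eq_def by (rule rtrancl_trans)

lemma sgp_eq_sym: "sgp_eq R x y \<Longrightarrow> sgp_eq R y x"
  unfolding sgp_eq_def by (rule symD[OF sym_rtrancl[OF sym_Un_converse]])

lemma rstep_append:
  assumes "(x, y) \<in> rstep R" shows "(a @ x @ b, a @ y @ b) \<in> rstep R"
proof -
  obtain p q l r where "(l, r) \<in> R" "x = p @ l @ q" "y = p @ r @ q"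
    using assms unfolding rstep_def by blast
  then have "(l, r) \<in> R" "a @ x @ b = (a @ p) @ l @ (q @ b)" "a @ y @ b = (a @ p) @ r @ (q @ b)" by simp_all
  then show ?thesis unfolding rstep_def by blast
qed

lemma sgp_eq_append:
  assumes "sgp_eq R x y" shows "sgp_eq R (a @ x @ b) (a @ y @ b)"
  using assms unfolding sgp_eq_def
proof (induction rule: rtrancl_induct)
  case (step y z)
  have "(a @ y @ b, a @ z @ b) \<in> rstep R \<union> (rstep R)\<inverse>"
    using step(2) rstep_append by blast
  then show ?case using step.IH by (rule rtrancl_into_rtrancl[rotated])
qed simp

section \<open>The deg-lex ordering and leading words\<close>

lemma deglex_wf: "wfP deglex_less"
  unfolding deglex_less_def wfp_def by (simp add: wf_lenlex)

lemma deglex_trans: "deglex_less x y \<Longrightarrow> deglex_less y z \<Longrightarrow> deglex_less x z"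
  unfolding deglex_less_def using lenlex_transI[of less_than] by (meson trans_less_than transD)

lemma deglex_irrefl: "\<not> deglex_less x x"
  unfolding deglex_less_def by (simp add: lenlex_irreflexive)

text \<open>On words of equal length the order is lexicographic, and the first difference is
  unaffected by a common prefix and suffix.\<close>

lemma deglex_append:
  assumes "deglex_less x y" "length x = length y"
  shows "deglex_less (a @ x @ b) (a @ y @ b)"
proof -
  have "(x, y) \<in> lex less_than" using assms by (simp add: deglex_less_def lenlex_conv)
  then have "(x @ b, y @ b) \<in> lex less_than" using assms by (simp add: lex_append_rightI)
  then have "(a @ x @ b, a @ y @ b) \<in> lex less_than" by (simp add: lex_append_leftI)
  then show ?thesis using assms by (simp add: deglex_less_def lenlex_conv)
qed

lemma lw_rel_poly:
  assumes "deglex_less v u"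
  shows "lw (rel_poly u v :: 'k::field ncpoly) = u"
proof -
  have "u \<noteq> v" using assms deglex_irrefl by blast
  then show ?thesis unfolding lw_def rel_poly_def
    using assms deglex_irrefl deglex_trans
    by (intro the_equality) (auto split: if_splits)
qed

lemma pmult_rel_poly:
  "pmult a (rel_poly u v) b = (rel_poly (a @ u @ b) (a @ v @ b) :: 'k::field ncpoly)"
proof
  fix w
  show "pmult a (rel_poly u v) b w = (rel_poly (a @ u @ b) (a @ v @ b) :: 'k ncpoly) w"
  proof (cases "\<exists>x. w = a @ x @ b")
    case True
    then obtain x where "w = a @ x @ b" by blast
    then show ?thesis by (simp add: pmult_def rel_poly_def)
  next
    case False
    then show ?thesis by (auto simp: pmult_def rel_poly_def)
  qed
qed

section \<open>Trivial compositions connect critical pairs\<close>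

text \<open>These are the rewriting steps that the summands of a trivial composition modulo
  \<open>w\<close> stand for.\<close>

definition below_eq :: "nat list \<Rightarrow> nat list \<Rightarrow> nat list \<Rightarrow> (nat list \<times> nat list) set" where
  "below_eq u v w = {(a @ u @ b, a @ v @ b) | a b. deglex_less (a @ u @ b) w}"

text \<open>Summing the coefficients over one class of the equivalence generated by the steps below \<open>w\<close>
  is a linear functional that kills every trivial polynomial.\<close>

lemma comp_trivial_connected:
  assumes "comp_trivial {rel_poly u v} (\<lambda>z. rel_poly y x z) w"
    and "deglex_less v u"
  shows "(x, y) \<in> (below_eq u v w \<union> (below_eq u v w)\<inverse>)\<^sup>*"
proof -
  let ?E = "(below_eq u v w \<union> (below_eq u v w)\<inverse>)\<^sup>*"
  obtain c :: "nat list \<times> 'a ncpoly \<times> nat list \<Rightarrow> 'a" where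
    fin: "finite {t. c t \<noteq> 0}"
    and c: "\<And>a s b. c (a, s, b) \<noteq> 0 \<Longrightarrow> s = rel_poly u v \<and> deglex_less (a @ lw s @ b) w"
    and eq: "rel_poly y x = (\<lambda>z. \<Sum>t\<in>{t. c t \<noteq> 0}. c t * pmult (fst t) (fst (snd t)) (snd (snd t)) z)"
    using assms(1) unfolding comp_trivial_def by auto
  let ?T = "{t. c t \<noteq> 0}"
  define l where "l t = fst t @ u @ snd (snd t)" for t :: "nat list \<times> 'a ncpoly \<times> nat list"
  define r where "r t = fst t @ v @ snd (snd t)" for t :: "nat list \<times> 'a ncpoly \<times> nat list"
  have pm: "pmult (fst t) (fst (snd t)) (snd (snd t)) = rel_poly (l t) (r t)"
    and below: "(l t, r t) \<in> below_eq u v w" if "t \<in> ?T" for t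
  proof -
    have "c (fst t, fst (snd t), snd (snd t)) \<noteq> 0" using that by simp
    from c[OF this] have s: "fst (snd t) = rel_poly u v" "deglex_less (fst t @ u @ snd (snd t)) w"
      using lw_rel_poly[OF assms(2)] by metis+
    show "pmult (fst t) (fst (snd t)) (snd (snd t)) = rel_poly (l t) (r t)"
      using s by (simp add: pmult_rel_poly l_def r_def)
    show "(l t, r t) \<in> below_eq u v w" using s unfolding below_eq_def l_def r_def by blast
  qed
  \<comment> \<open>Indicator of the class of \<open>x\<close>. Extended linearly, it vanishes on
    every summand, because the two words of a summand lie in the same class.\<close>
  define f :: "nat list \<Rightarrow> 'a" where "f z = (if (x, z) \<in> ?E then 1 else 0)" for z
  have f_eq: "f (l t) = f (r t)" if "t \<in> ?T" for t
  proof -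
    have "(l t, r t) \<in> below_eq u v w \<union> (below_eq u v w)\<inverse>"
      and "(r t, l t) \<in> below_eq u v w \<union> (below_eq u v w)\<inverse>" using below[OF that] by auto
    then show ?thesis unfolding f_def by (meson rtrancl.rtrancl_into_rtrancl)
  qed
  \<comment> \<open>A finite set containing every word involved, so that the functional becomes a
    finite sum.\<close>
  define W where "W = {x, y} \<union> l ` ?T \<union> r ` ?T"
  have finW: "finite W" using fin by (simp add: W_def)
  have functional: "(\<Sum>z\<in>W. f z * rel_poly p q z) = f p - f q" if "p \<in> W" "q \<in> W" for p q
  proof -
    have "(\<Sum>z\<in>W. f z * rel_poly p q z) = (\<Sum>z\<in>W. (if z = p then f z else 0) - (if z = q then f z else 0))"
      by (intro sum.cong) (auto simp: rel_poly_def algebra_simps)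
    also have "\<dots> = f p - f q" using that finW by (simp add: sum_subtractf)
    finally show ?thesis .
  qed
  have "f y - f x = (\<Sum>z\<in>W. f z * rel_poly y x z)" using functional by (simp add: W_def)
  also have "\<dots> = (\<Sum>z\<in>W. \<Sum>t\<in>?T. c t * (f z * rel_poly (l t) (r t) z))"
    using pm by (subst eq) (auto simp: sum_distrib_left mult.left_commute intro!: sum.cong)
  also have "\<dots> = (\<Sum>t\<in>?T. c t * (\<Sum>z\<in>W. f z * rel_poly (l t) (r t) z))"
    by (subst sum.swap) (simp add: sum_distrib_left)
  also have "\<dots> = (\<Sum>t\<in>?T. c t * (f (l t) - f (r t)))"
    by (intro sum.cong refl arg_cong2[of _ _ _ _ "(*)"] functional) (auto simp: W_def)
  also have "\<dots> = 0" using f_eq by simp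
  finally have "f y = f x" by simp
  \<comment> \<open>\<open>f x\<close> is 1 by reflexivity, so \<open>f y\<close> is 1 as well and
    \<open>y\<close> lies in the class of \<open>x\<close>.\<close>
  then show ?thesis by (auto simp: f_def split: if_splits)
qed

text \<open>Since \<open>u b = a u\<close>, the composition \<open>(u - v) b - a (u - v)\<close>
  equals \<open>a v - v b\<close>, the difference of the two reducts of the overlap.\<close>

lemma GS_basis_overlap:
  assumes "GS_basis {rel_poly u v :: 'k::field ncpoly}" "deglex_less v u"
    and "u @ b = a @ u" "length b < length u"
  shows "(a @ v, v @ b) \<in> (below_eq u v (u @ b) \<union> (below_eq u v (u @ b))\<inverse>)\<^sup>*"
proof -
  let ?f = "rel_poly u v :: 'k ncpoly"
  have len: "length a = length b" using arg_cong[OF assms(3), of length] by simp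
  have lw: "lw ?f = u" using assms(2) by (rule lw_rel_poly)
  have "comp_trivial {?f} (\<lambda>x. pmult [] ?f b x - pmult a ?f [] x) w"
    if "w = lw ?f @ b \<and> w = a @ lw ?f \<and> length (lw ?f) + length (lw ?f) > length w" for w
    using assms(1) that unfolding GS_basis_def by blast
  then have "comp_trivial {?f} (\<lambda>x. pmult [] ?f b x - pmult a ?f [] x) (u @ b)"
    using assms(3,4) lw len by simp
  moreover have "(\<lambda>x. pmult [] ?f b x - pmult a ?f [] x) = (\<lambda>x. (rel_poly (a @ v) (v @ b) x :: 'k))"
    using assms(3) by (auto simp: pmult_rel_poly fun_eq_iff) (auto simp: rel_poly_def)
  ultimately have "(v @ b, a @ v) \<in> (below_eq u v (u @ b) \<union> (below_eq u v (u @ b))\<inverse>)\<^sup>*"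
    using comp_trivial_connected[OF _ assms(2)] by metis
  then show ?thesis by (rule symD[OF sym_rtrancl[OF sym_Un_converse]])
qed

lemma append_eq_append_le:
  assumes "x @ p = y @ q" "length x \<le> length y"
  obtains a where "y = x @ a" "p = a @ q"
  using assms by (auto simp: append_eq_append_conv2)

text \<open>Coinciding occurrences of a nonempty \<open>u\<close> fall under the second alternative
  with \<open>a = b = []\<close>.\<close>

lemma overlapping_occurrences:
  assumes "x1 @ u @ y1 = x2 @ u @ y2" "length x1 \<le> length x2"
  shows "(\<exists>m. x2 = x1 @ u @ m \<and> y1 = m @ u @ y2) \<or>
    (\<exists>a b. x2 = x1 @ a \<and> y1 = b @ y2 \<and> u @ b = a @ u \<and> length b < length u)"
proof -
  obtain a where a: "x2 = x1 @ a" "u @ y1 = a @ u @ y2"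
    using assms by (rule append_eq_append_le)
  show ?thesis
  proof (cases "length u \<le> length a")
    case True
    then obtain m where "a = u @ m" "y1 = m @ u @ y2"
      using a(2) append_eq_append_le by metis
    then show ?thesis using a by simp
  next
    case False
    have "length y1 = length a + length y2" using arg_cong[OF a(2), of length] by simp
    then obtain b c where b: "y1 = b @ c" "length b = length a"
      by (metis append_take_drop_id le_add1 length_take min_absorb2)
    then have "(u @ b) @ c = (a @ u) @ y2" using a(2) by simp
    then have "u @ b = a @ u \<and> c = y2" using b(2) by (subst (asm) append_eq_append_conv) auto
    then show ?thesis using a b False by auto
  qed
qed

section \<open>Termination and confluence\<close>

text \<open>Each reduction descends in the deg-lex order. The letters are tracked so that normal
  forms remain words over the given generators.\<close>

lemma ex_nf:
  assumes "deglex_less v u" "length v = length u" "set v \<subseteq> A" "set w \<subseteq> A"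
  shows "\<exists>z. avoids u z \<and> (w, z) \<in> (rstep {(u, v)})\<^sup>* \<and> set z \<subseteq> A"
  using assms(4)
proof (induction w rule: wfp_induct_rule[OF deglex_wf])
  case (1 w)
  show ?case
  proof (cases "avoids u w")
    case False
    then obtain x y where w: "w = x @ u @ y" by (auto simp: avoids_def)
    have "deglex_less (x @ v @ y) w" using deglex_append assms w by simp
    moreover have "set (x @ v @ y) \<subseteq> A" using 1(2) w assms(3) by simp
    ultimately obtain z where "avoids u z" "(x @ v @ y, z) \<in> (rstep {(u, v)})\<^sup>*" "set z \<subseteq> A"
      using 1(1) by blast
    moreover have "(w, x @ v @ y) \<in> rstep {(u, v)}" using w by (auto simp: rstep_single)
    ultimately show ?thesis by (meson converse_rtrancl_into_rtrancl)
  qed (use 1 in blast)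
qed

lemma rtrancl_rstep_imp_sgp_eq: "(x, y) \<in> (rstep R)\<^sup>* \<Longrightarrow> sgp_eq R x y"
  unfolding sgp_eq_def using rtrancl_mono[of "rstep R"] by blast

text \<open>Newman's argument with critical pairs: by well-founded induction the words below
  \<open>w\<close> have unique normal forms, so two reducts of \<open>w\<close> only have to be
  connected through words below \<open>w\<close>.\<close>

lemma confluent_nf:
  assumes GS: "GS_basis {rel_poly u v :: 'k::field ncpoly}" and vu: "deglex_less v u" and len: "length v = length u"
    and "(w, y) \<in> (rstep {(u, v)})\<^sup>*" "(w, z) \<in> (rstep {(u, v)})\<^sup>*" "avoids u y" "avoids u z"
  shows "y = z"
  using assms(4-)
proof (induction w arbitrary: y z rule: wfp_induct_rule[OF deglex_wf])
  case (1 w)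
  let ?S = "rstep {(u, v)}"
  define N where "N x y \<longleftrightarrow> (\<exists>z. avoids u z \<and> (x, z) \<in> ?S\<^sup>* \<and> (y, z) \<in> ?S\<^sup>*)" for x y
  have less: "deglex_less q p" if "(p, q) \<in> ?S" for p q
    using that deglex_append[OF vu len] by (auto simp: rstep_single)
  have nf: "\<exists>z. avoids u z \<and> (x, z) \<in> ?S\<^sup>*" for x
    using ex_nf[OF vu len, of UNIV x] by auto
  have N_sym: "N x y \<Longrightarrow> N y x" for x y by (auto simp: N_def)
  \<comment> \<open>The induction hypothesis makes \<open>N\<close> transitive only through words
    below \<open>w\<close>.\<close>
  have N_trans: "N x z" if "N x y" "N y z" "deglex_less y w" for x y z
    using that 1(1) unfolding N_def by metis
  have N_step: "N x y" if "(x, y) \<in> ?S" for x y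
    using that nf[of y] unfolding N_def by (meson converse_rtrancl_into_rtrancl)
  have connected: "N (c @ x @ d) (c @ y @ d)"
    if "(x, y) \<in> (below_eq u v w' \<union> (below_eq u v w')\<inverse>)\<^sup>*" "w = c @ w' @ d" "length x = length w'" "deglex_less x w'"
    for c d w' x y
  proof -
    \<comment> \<open>Every word of the chain has the length of \<open>w'\<close> and lies below it;
      hence in the context of \<open>c\<close> and \<open>d\<close> it lies below \<open>w\<close>,
      as \<open>N_trans\<close> requires.\<close>
    have "N (c @ x @ d) (c @ y @ d) \<and> length y = length w' \<and> deglex_less y w'"
      using that(1)
    proof (induction rule: rtrancl_induct)
      case base
      then show ?case using nf that by (auto simp: N_def)
    next
      case (step y z)
      have lt: "deglex_less (c @ y @ d) w" using deglex_append step that by blast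
      have *: "N (c @ p @ d) (c @ q @ d) \<and> length p = length q \<and> deglex_less q w' \<and> deglex_less p w'"
        if "(p, q) \<in> below_eq u v w'" for p q
      proof -
        obtain a b where ab: "p = a @ u @ b" "q = a @ v @ b" "deglex_less p w'"
          using \<open>(p, q) \<in> below_eq u v w'\<close> unfolding below_eq_def by blast
        have "c @ p @ d = (c @ a) @ u @ (b @ d)" "c @ q @ d = (c @ a) @ v @ (b @ d)" using ab by auto
        then have "(c @ p @ d, c @ q @ d) \<in> ?S" unfolding rstep_single by blast
        then have "N (c @ p @ d) (c @ q @ d)" by (rule N_step)
        moreover have "deglex_less q p" using deglex_append[OF vu len] ab by simp
        ultimately show ?thesis using ab len deglex_trans by auto
      qed
      have "N (c @ y @ d) (c @ z @ d) \<and> length z = length w' \<and> deglex_less z w'"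
        using step(2)
      proof
        assume "(y, z) \<in> below_eq u v w'"
        then show ?thesis using * step.IH by metis
      next
        assume "(y, z) \<in> (below_eq u v w')\<inverse>"
        then show ?thesis using *[of z y] step.IH N_sym by auto
      qed
      then show ?case using step.IH N_trans lt by blast
    qed
    then show ?thesis by blast
  qed
  have peak: "N (x1 @ v @ y1) (x2 @ v @ y2)"
    if eq: "w = x1 @ u @ y1" "w = x2 @ u @ y2" and le: "length x1 \<le> length x2" for x1 x2 y1 y2
  proof -
    consider (disjoint) m where "x2 = x1 @ u @ m" "y1 = m @ u @ y2"
      | (overlap) a b where "x2 = x1 @ a" "y1 = b @ y2" "u @ b = a @ u" "length b < length u"
      using overlapping_occurrences[of x1 u y1 x2 y2] eq le by metis
    then show ?thesis
    proof cases
      case (disjoint m)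
      \<comment> \<open>Disjoint reductions commute; \<open>?z\<close> is the result of
        both.\<close>
      let ?z = "x1 @ v @ m @ v @ y2"
      have "x1 @ v @ y1 = (x1 @ v @ m) @ u @ y2" "?z = (x1 @ v @ m) @ v @ y2" using disjoint by simp_all
      then have "(x1 @ v @ y1, ?z) \<in> ?S" unfolding rstep_single by blast
      moreover have "x2 @ v @ y2 = x1 @ u @ (m @ v @ y2)" using disjoint by simp
      then have "(x2 @ v @ y2, ?z) \<in> ?S" unfolding rstep_single by blast
      ultimately show ?thesis using nf[of ?z] unfolding N_def by (meson converse_rtrancl_into_rtrancl)
    next
      case (overlap a b)
      \<comment> \<open>The chain starts at \<open>a @ v\<close>, which is below the overlap because
        \<open>u @ b = a @ u\<close>.\<close>
      have "deglex_less (a @ v) (u @ b)"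
        using deglex_append[OF vu len, of a "[]"] overlap by simp
      moreover have "length (a @ v) = length (u @ b)" using overlap(3) len by (metis length_append)
      ultimately have "N (x1 @ (a @ v) @ y2) (x1 @ (v @ b) @ y2)"
        using connected[OF GS_basis_overlap[OF GS vu overlap(3,4)], of x1 y2] eq overlap by simp
      then show ?thesis using overlap N_sym by simp
    qed
  qed
  have N1: "N y1 z1" if "(w, y1) \<in> ?S" "(w, z1) \<in> ?S" for y1 z1
    using that peak N_sym unfolding rstep_single by (smt (verit) Pair_inject mem_Collect_eq nle_le)
  have irr: "\<not> (x, q) \<in> ?S" if "avoids u x" for x q using that by (auto simp: avoids_def rstep_single)
  show ?case
  proof (cases "avoids u w")
    case True
    then show ?thesis using 1(2,3) irr by (metis converse_rtranclE)
  next
    case False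
    then have "w \<noteq> y" "w \<noteq> z" using 1 by auto
    then obtain y1 z1 where s: "(w, y1) \<in> ?S" "(y1, y) \<in> ?S\<^sup>*" "(w, z1) \<in> ?S" "(z1, z) \<in> ?S\<^sup>*"
      using 1(2,3) by (meson converse_rtranclE)
    obtain q where "avoids u q" "(y1, q) \<in> ?S\<^sup>*" "(z1, q) \<in> ?S\<^sup>*"
      using N1[OF s(1,3)] by (auto simp: N_def)
    then show ?thesis using 1(1) s less 1(4,5) by metis
  qed
qed

text \<open>Along a zigzag of steps the normal form of its first word stays reachable: confluence
  handles a forward step, and a backward step only prolongs the reduction.\<close>

lemma GS_basis_imp_unique_nf:
  assumes GS: "GS_basis {rel_poly u v :: 'k::field ncpoly}" and vu: "deglex_less v u" and len: "length v = length u"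
  shows "unique_nf u v"
  unfolding unique_nf_def
proof (intro allI impI)
  fix x y assume A: "avoids u x \<and> avoids u y \<and> sgp_eq {(u, v)} x y"
  let ?S = "rstep {(u, v)}"
  have nf: "\<exists>z. avoids u z \<and> (x, z) \<in> ?S\<^sup>*" for x
    using ex_nf[OF vu len, of UNIV x] by auto
  have "(x, y) \<in> (?S \<union> ?S\<inverse>)\<^sup>*" using A by (simp add: sgp_eq_def)
  then have "\<exists>z. avoids u z \<and> (x, z) \<in> ?S\<^sup>* \<and> (y, z) \<in> ?S\<^sup>*"
  proof (induction rule: rtrancl_induct)
    case base
    then show ?case using nf by blast
  next
    case (step p q)
    then obtain z where z: "avoids u z" "(x, z) \<in> ?S\<^sup>*" "(p, z) \<in> ?S\<^sup>*" by blast
    from step(2) show ?case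
    proof
      assume "(p, q) \<in> ?S"
      moreover obtain z' where "avoids u z'" "(q, z') \<in> ?S\<^sup>*" using nf by blast
      ultimately have "z' = z" using z confluent_nf[OF GS vu len] by (meson converse_rtrancl_into_rtrancl)
      then show ?thesis using z \<open>(q, z') \<in> ?S\<^sup>*\<close> by blast
    next
      assume "(p, q) \<in> ?S\<inverse>"
      then show ?thesis using z by (meson converse_iff converse_rtrancl_into_rtrancl)
    qed
  qed
  moreover have "z = x" if "avoids u x" "(x, z) \<in> ?S\<^sup>*" for x z
    using that(2,1) by (cases rule: converse_rtranclE) (auto simp: avoids_def rstep_single)
  ultimately show "x = y" using A by metis
qed

section \<open>Cascades of reductions\<close>

text \<open>The blocks by which a cascade of reductions moves left: \<open>p\<close> is consumed in front of \<open>v\<close> and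
  \<open>q\<close> is left behind, since \<open>p @ v = p @ s @ q = u @ q\<close> reduces to \<open>v @ q\<close>.\<close>

definition moves :: "'a list \<Rightarrow> 'a list \<Rightarrow> ('a list \<times> 'a list) set" where
  "moves u v = {(p, q). \<exists>s. s \<noteq> [] \<and> p \<noteq> [] \<and> u = p @ s \<and> v = s @ q}"

text \<open>A pair \<open>(w, z)\<close> records that \<open>w @ u\<close> reduces to
  \<open>v @ z\<close>. Later moves are put in front, since the block \<open>v\<close> travels to
  the left.\<close>

inductive_set cascade :: "'a list \<Rightarrow> 'a list \<Rightarrow> ('a list \<times> 'a list) set" for u v where
  cascade_Nil: "([], []) \<in> cascade u v"
| cascade_move: "(p, q) \<in> moves u v \<Longrightarrow> (w, z) \<in> cascade u v \<Longrightarrow> (p @ w, q @ z) \<in> cascade u v"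

text \<open>No occurrence of \<open>u\<close> begins in the block \<open>v\<close> or to its right,
  so a new occurrence has to straddle the left end of the block or lie before it.\<close>

definition moves_left :: "'a list \<Rightarrow> 'a list \<Rightarrow> bool" where
  "moves_left u v \<longleftrightarrow> (\<forall>w z. (w, z) \<in> cascade u v \<longrightarrow> avoids u (v @ z))"

definition unbordered :: "'a list \<Rightarrow> bool" where
  "unbordered w \<longleftrightarrow> (\<nexists>b x y. b \<noteq> [] \<and> x \<noteq> [] \<and> w = b @ x \<and> w = y @ b)"

section \<open>Conditions under which cascades move only to the left\<close>

lemma append_eq_append_ge:
  assumes "p @ x = q @ y" "length x \<le> length y"
  obtains a where "y = a @ x" "p = q @ a"
proof -
  have "length q \<le> length p" using arg_cong[OF assms(1), of length] assms(2) by simp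
  then show thesis using append_eq_append_le[OF assms(1)[symmetric]] that by metis
qed

text \<open>Without moves only the empty cascade exists, and \<open>v\<close> contains no other word
  of its own length.\<close>

lemma moves_left_if_no_overlap:
  assumes "moves u v = {}" "length u = length v" "u \<noteq> v"
  shows "moves_left u v"
proof -
  have "z = []" if "(w, z) \<in> cascade u v" for w z
    using that assms(1) by cases auto
  moreover have "avoids u v"
  proof -
    have "v \<noteq> x @ u @ y" for x y
      using assms(2,3) by (cases "x = [] \<and> y = []") auto
    then show ?thesis by (simp add: avoids_def)
  qed
  ultimately show ?thesis unfolding moves_left_def by (metis append_Nil2)
qed

text \<open>Every residue \<open>q\<close> of a move is a suffix of \<open>v\<close>, so
  \<open>v @ z\<close> has only letters of \<open>v\<close>.\<close>

lemma moves_left_if_not_subset: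
  assumes "\<not> set u \<subseteq> set v"
  shows "moves_left u v"
proof -
  have "set z \<subseteq> set v" if "(w, z) \<in> cascade u v" for w z
    using that by induction (auto simp: moves_def)
  moreover have "set u \<subseteq> set (v @ z)" if notav: "\<not> avoids u (v @ z)" for z
  proof -
    obtain x y where "v @ z = x @ u @ y" using notav unfolding avoids_def by blast
    then have "set (v @ z) = set (x @ u @ y)" by (rule arg_cong)
    then show ?thesis by auto
  qed
  ultimately show ?thesis using assms unfolding moves_left_def by fastforce
qed

text \<open>An occurrence of \<open>u\<close> begins with the suffix \<open>v2\<close> of the block
  and ends within the residue \<open>q @ r\<close> of a move along \<open>s\<close>. If
  \<open>s\<close> is longer than \<open>q\<close>, its part \<open>s1\<close> after
  \<open>x\<close> is a border of \<open>u\<close>; otherwise \<open>s\<close> itself is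
  one.\<close>

lemma bordered_if_right_overlap:
  assumes u: "u = p @ s" "u = v2 @ q" and v: "v = s @ q @ r" "v = x @ v2"
    and len: "length u = length v" and ne: "s \<noteq> []" "p \<noteq> []" "q \<noteq> []"
  shows "\<not> unbordered u"
proof (cases "length q < length s")
  case True
  have "length x = length q" using u(2) v(2) len by simp
  then obtain s1 where s1: "s = x @ s1" "v2 = s1 @ q @ r"
    using append_eq_append_le[of x v2 s "q @ r"] True v by auto
  then have "s1 \<noteq> []" using True \<open>length x = length q\<close> by auto
  moreover have "u = s1 @ (q @ r @ q)" "u = (p @ x) @ s1" using u s1 by simp_all
  ultimately show ?thesis using ne(3) unfolding unbordered_def by blast
next
  case False
  then obtain a where a: "q = a @ s" "p = v2 @ a"
    using append_eq_append_ge[of p s v2 q] u by auto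
  have "length x = length q" using u(2) v(2) len by simp
  then have "x @ v2 = (s @ a) @ (s @ r)" "length x = length (s @ a)" using v a by auto
  then have "v2 = s @ r" by (metis append_eq_append_conv)
  then have "u = s @ (r @ q)" "u = p @ s" using u by simp_all
  then show ?thesis using ne unfolding unbordered_def by blast
qed

text \<open>Here the occurrence of \<open>u\<close> covers the whole residue \<open>q\<close>. The
  border of \<open>v\<close> is the part \<open>t\<close> of \<open>v2\<close> after
  \<open>p\<close> if \<open>v2\<close> is longer than \<open>q\<close>, and \<open>v2\<close>
  itself otherwise.\<close>

lemma bordered_if_far_right_overlap:
  assumes u: "u = p @ s" "u = v2 @ q @ q'" and v: "v = s @ q" "v = x @ v2"
    and len: "length u = length v" and ne: "s \<noteq> []" "q \<noteq> []" "x \<noteq> []" "v2 \<noteq> []"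
  shows "\<not> unbordered v"
proof (cases "length q < length v2")
  case True
  have "length p = length q" using u(1) v(1) len by simp
  then obtain t where t: "v2 = p @ t" "s = t @ q @ q'"
    using append_eq_append_le[of p s v2 "q @ q'"] True u by auto
  then have "t \<noteq> []" using True \<open>length p = length q\<close> by auto
  moreover have "v = t @ (q @ q' @ q)" "v = (x @ p) @ t" using v t by simp_all
  ultimately show ?thesis using ne unfolding unbordered_def by blast
next
  case False
  then obtain c where c: "q = c @ v2" "x = s @ c"
    using append_eq_append_ge[of x v2 s q] v by auto
  have "length p = length q" using u(1) v(1) len by simp
  then have "p @ s = (v2 @ c) @ (v2 @ q')" "length p = length (v2 @ c)" using u c by auto
  then have "s = v2 @ q'" by (metis append_eq_append_conv)
  then have "v = v2 @ (q' @ q)" "v = x @ v2" using v by simp_all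
  then show ?thesis using ne unfolding unbordered_def by blast
qed

lemma moves_left_if_unbordered:
  assumes "unbordered u" "unbordered v \<or> distinct u" "length u = length v" "u \<noteq> v"
  shows "moves_left u v"
proof -
  have "avoids u (v @ z)" if "(w, z) \<in> cascade u v" for w z
    using that
  proof induction
    case cascade_Nil
    have "v \<noteq> x @ u @ y" for x y
      using assms(3,4) by (cases "x = [] \<and> y = []") auto
    then show ?case by (simp add: avoids_def)
  next
    case (cascade_move p q w z)
    obtain s where s: "s \<noteq> []" "p \<noteq> []" "u = p @ s" "v = s @ q"
      using cascade_move(1) unfolding moves_def by auto
    have "q \<noteq> []" using s assms(3) by auto
    show ?case unfolding avoids_def
    proof (intro notI, elim exE)
      fix x y assume eq: "v @ q @ z = x @ u @ y"
      show False
      proof (cases "length v \<le> length x")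
        \<comment> \<open>\<open>q @ z\<close> is a suffix of \<open>v @ z\<close>, which avoids
          \<open>u\<close> by induction.\<close>
        case True
        then obtain a where "q @ z = a @ u @ y" using append_eq_append_le[OF eq] by metis
        then have "v @ z = (s @ a) @ u @ y" using s by simp
        then show False using cascade_move.IH unfolding avoids_def by blast
      next
        case False
        then obtain v2 where v2: "v = x @ v2" "u @ y = v2 @ q @ z"
          using append_eq_append_le[OF eq[symmetric]] by (metis nat_le_linear)
        have "v2 \<noteq> []" using False v2 by auto
        have "x \<noteq> []"
        proof
          assume "x = []"
          then have "u @ y = v @ q @ z" using v2 by simp
          then show False using assms(3,4) append_eq_append_conv by metis
        qed
        then have "length v2 \<le> length u" "length v2 < length u" using v2 assms(3) by auto
        then obtain q1 where q1: "u = v2 @ q1" "q @ z = q1 @ y"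
          using append_eq_append_le[OF v2(2)[symmetric]] by metis
        have "q1 \<noteq> []" using q1 \<open>length v2 < length u\<close> by auto
        show False
        proof (cases "length q1 \<le> length q")
          case True
          then obtain r where "q = q1 @ r" using append_eq_append_le[OF q1(2)[symmetric]] by metis
          then have "v = s @ q1 @ r" using s by simp
          then show False
            using bordered_if_right_overlap[OF s(3) q1(1) _ v2(1) assms(3) s(1,2) \<open>q1 \<noteq> []\<close>] assms(1) by blast
        next
          case False
          then obtain q' where "q1 = q @ q'" using append_eq_append_le[OF q1(2)] by (metis nat_le_linear)
          then have u: "u = v2 @ q @ q'" using q1 by simp
          \<comment> \<open>Both words are nonempty suffixes of \<open>v\<close>, so they share the
            last letter, and \<open>u\<close> contains that letter twice.\<close>
          have "last v2 = last q" using v2(1) s(4) \<open>v2 \<noteq> []\<close> \<open>q \<noteq> []\<close> by (metis last_appendR)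
          then have "\<not> distinct u" unfolding u using \<open>v2 \<noteq> []\<close> \<open>q \<noteq> []\<close>
            by (metis IntI UnCI distinct_append empty_iff last_in_set set_append)
          moreover have "\<not> unbordered v"
            using bordered_if_far_right_overlap[OF s(3) u s(4) v2(1) assms(3) s(1) \<open>q \<noteq> []\<close> \<open>x \<noteq> []\<close> \<open>v2 \<noteq> []\<close>] .
          ultimately show False using assms(2) by blast
        qed
      qed
    qed
  qed
  then show ?thesis by (auto simp: moves_left_def)
qed

text \<open>A shortest border of a word does not overlap itself.\<close>

lemma bordered_imp_short_border:
  assumes "w = b @ x" "w = y @ b" "b \<noteq> []" "x \<noteq> []"
  shows "\<exists>c m. c \<noteq> [] \<and> w = c @ m @ c"
  using assms
proof (induction "length b" arbitrary: b x y rule: less_induct)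
  case less
  show ?case
  proof (cases "length b \<le> length y")
    case True
    then obtain a where "y = b @ a"
      using append_eq_append_le[of b x y b] less.prems by metis
    then show ?thesis using less.prems by auto
  next
    case False
    \<comment> \<open>A border longer than \<open>y\<close> overlaps itself in \<open>z\<close>,
      which is a shorter border.\<close>
    then obtain z where z: "b = y @ z" "b = z @ x"
      using append_eq_append_le[of y b b x] less.prems by (metis nat_le_linear)
    have "z \<noteq> []" using False z(1) by auto
    moreover have "length z < length b" using z(2) less.prems(4) by simp
    moreover have "w = z @ (x @ x)" using z(2) less.prems(1) by simp
    moreover have "w = (y @ y) @ z" using z(1) less.prems(2) by simp
    ultimately show ?thesis using less.hyps[of z "x @ x" "y @ y"] less.prems by blast
  qed
qed

text \<open>Excluding borders whose two copies do not overlap already excludes all borders.\<close>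

lemma unbordered_if_no_short_border:
  assumes "\<And>c m. c \<noteq> [] \<Longrightarrow> w \<noteq> c @ m @ c"
  shows "unbordered w"
  using assms bordered_imp_short_border unfolding unbordered_def by metis

lemma distinct_imp_unbordered:
  assumes "distinct w" shows "unbordered w"
proof (rule unbordered_if_no_short_border)
  fix c m :: "'a list" assume "c \<noteq> []"
  then show "w \<noteq> c @ m @ c" using assms by (cases c) auto
qed

lemma unbordered_rev: "unbordered (rev w) \<longleftrightarrow> unbordered w"
proof -
  have "unbordered (rev w)" if "unbordered w" for w :: "'a list"
    unfolding unbordered_def
  proof (intro notI, elim exE conjE)
    fix b x y assume "b \<noteq> []" "x \<noteq> []" "rev w = b @ x" "rev w = y @ b"
    then have "w = rev x @ rev b" "w = rev b @ rev y" by (metis rev_append rev_rev_ident)+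
    moreover have "length (y @ b) = length (b @ x)" using \<open>rev w = b @ x\<close> \<open>rev w = y @ b\<close> by simp
    then have "y \<noteq> []" using \<open>x \<noteq> []\<close> by auto
    ultimately show False using that \<open>b \<noteq> []\<close> unfolding unbordered_def by (metis rev_is_Nil_conv)
  qed
  from this[of w] this[of "rev w"] show ?thesis by auto
qed

section \<open>Normal forms of products with a letter\<close>

lemma cascade_imp_sgp_eq:
  assumes "(w, z) \<in> cascade u v" shows "sgp_eq {(u, v)} (w @ u) (v @ z)"
  using assms
proof induction
  case cascade_Nil
  show ?case using sgp_eq_step[of u v "[]" "[]"] by simp
next
  case (cascade_move p q w z)
  then obtain s where s: "u = p @ s" "v = s @ q" by (auto simp: moves_def)
  have "sgp_eq {(u, v)} (p @ w @ u) (u @ q @ z)"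
    using sgp_eq_append[OF cascade_move.IH, of p "[]"] s by simp
  moreover have "sgp_eq {(u, v)} (u @ q @ z) (v @ q @ z)"
    using sgp_eq_step[of u v "[]" "q @ z"] by simp
  ultimately have "sgp_eq {(u, v)} (p @ w @ u) (v @ q @ z)" by (rule sgp_eq_trans)
  then show ?case by simp
qed

text \<open>While \<open>g @ v @ z\<close> is reducible, a further move consumes a nonempty suffix
  of \<open>g\<close>; this ends because \<open>g\<close> gets shorter.\<close>

lemma cascade_reaches_nf:
  assumes "moves_left u v" "length u = length v" "avoids u g" "(w, z) \<in> cascade u v"
  shows "\<exists>g' w' z'. (w', z') \<in> cascade u v \<and> g @ w = g' @ w' \<and> avoids u (g' @ v @ z')"
  using assms(3,4)
proof (induction "length g" arbitrary: g w z rule: less_induct)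
  case less
  show ?case
  proof (cases "avoids u (g @ v @ z)")
    case True
    then show ?thesis using less.prems by blast
  next
    case False
    then obtain x y where eq: "g @ v @ z = x @ u @ y" by (auto simp: avoids_def)
    \<comment> \<open>An occurrence beginning in the block or after it contradicts
      \<open>moves_left\<close>.\<close>
    have "length x < length g"
    proof (rule ccontr)
      assume "\<not> ?thesis"
      then obtain a where "v @ z = a @ u @ y" using append_eq_append_le[OF eq] by (metis leI)
      then show False using assms(1) less.prems(2) unfolding moves_left_def avoids_def by blast
    qed
    then obtain p where p: "g = x @ p" "u @ y = p @ v @ z"
      using append_eq_append_le[OF eq[symmetric]] by (metis less_imp_le)
    \<comment> \<open>An occurrence inside \<open>g\<close> contradicts the irreducibility of
      \<open>g\<close>.\<close>
    have "length p < length u"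
    proof (rule ccontr)
      assume "\<not> ?thesis"
      then obtain a where "p = u @ a" using append_eq_append_le[OF p(2)] by (metis leI)
      then show False using less.prems(1) p(1) unfolding avoids_def by blast
    qed
    then obtain s where s: "u = p @ s" "v @ z = s @ y"
      using append_eq_append_le[OF p(2)[symmetric]] by (metis less_imp_le)
    \<comment> \<open>The occurrence ends within \<open>v\<close>, since \<open>u\<close> is no
      longer than \<open>v\<close>.\<close>
    have "length s \<le> length v" using s(1) assms(2) by simp
    then obtain q where q: "v = s @ q" "y = q @ z"
      using append_eq_append_le[OF s(2)[symmetric]] by metis
    have "p \<noteq> []" "s \<noteq> []" using p(1) \<open>length x < length g\<close> s(1) \<open>length p < length u\<close> by auto
    then have "(p, q) \<in> moves u v" using s(1) q(1) unfolding moves_def by blast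
    then have "(p @ w, q @ z) \<in> cascade u v" using less.prems(2) by (rule cascade.cascade_move)
    moreover have "avoids u x" using less.prems(1) p(1) avoids_factor[of u "[]" x p] by simp
    ultimately show ?thesis using less.hyps[OF \<open>length x < length g\<close>, of "p @ w" "q @ z"] p(1) by simp
  qed
qed

text \<open>As \<open>\<alpha>\<close> is irreducible, \<open>u\<close> can occur in
  \<open>\<alpha> @ [a]\<close> only as a suffix. The cascade started there reaches a normal form,
  which is \<open>\<beta>\<close> by uniqueness.\<close>

lemma right_mult_iff_cascade:
  assumes "unique_nf u v" "moves_left u v" "length u = length v" "avoids u \<alpha>" "avoids u \<beta>"
  shows "sgp_eq {(u, v)} (\<alpha> @ [a]) \<beta> \<longleftrightarrow>
    \<beta> = \<alpha> @ [a] \<or> (\<exists>g w z. (w, z) \<in> cascade u v \<and> \<alpha> @ [a] = g @ w @ u \<and> \<beta> = g @ v @ z)"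
proof
  assume eq: "sgp_eq {(u, v)} (\<alpha> @ [a]) \<beta>"
  show "\<beta> = \<alpha> @ [a] \<or> (\<exists>g w z. (w, z) \<in> cascade u v \<and> \<alpha> @ [a] = g @ w @ u \<and> \<beta> = g @ v @ z)"
  proof (cases "avoids u (\<alpha> @ [a])")
    case True
    then show ?thesis using eq assms(1,5) unfolding unique_nf_def by metis
  next
    case False
    then obtain x y where xy: "\<alpha> @ [a] = x @ u @ y" by (auto simp: avoids_def)
    have "y = []"
    proof (rule ccontr)
      assume "y \<noteq> []"
      then have "\<alpha> = x @ u @ butlast y" using arg_cong[OF xy, of butlast] by (simp add: butlast_append)
      then show False using assms(4) by (auto simp: avoids_def)
    qed
    show ?thesis
    proof (cases "u = []")
      case True
      then show ?thesis using assms(4) unfolding avoids_def by (metis append_Nil)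
    next
      case False
      then have "\<alpha> = x @ butlast u" using arg_cong[OF xy, of butlast] \<open>y = []\<close> by (simp add: butlast_append)
      then have "avoids u x" using assms(4) avoids_factor[of u "[]" x "butlast u"] by simp
      then obtain g w z where g: "(w, z) \<in> cascade u v" "x = g @ w" "avoids u (g @ v @ z)"
        using cascade_reaches_nf[OF assms(2,3) _ cascade.cascade_Nil, of x] by auto
      then have "sgp_eq {(u, v)} (\<alpha> @ [a]) (g @ v @ z)"
        using sgp_eq_append[OF cascade_imp_sgp_eq[OF g(1)], of g "[]"] xy \<open>y = []\<close> by simp
      then have "sgp_eq {(u, v)} \<beta> (g @ v @ z)" by (rule sgp_eq_trans[OF sgp_eq_sym[OF eq]])
      then have "\<beta> = g @ v @ z" using assms(1,5) g(3) unfolding unique_nf_def by blast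
      then show ?thesis using g xy \<open>y = []\<close> by auto
    qed
  qed
next
  assume "\<beta> = \<alpha> @ [a] \<or> (\<exists>g w z. (w, z) \<in> cascade u v \<and> \<alpha> @ [a] = g @ w @ u \<and> \<beta> = g @ v @ z)"
  then show "sgp_eq {(u, v)} (\<alpha> @ [a]) \<beta>"
  proof (elim disjE exE conjE)
    fix g w z assume "(w, z) \<in> cascade u v" "\<alpha> @ [a] = g @ w @ u" "\<beta> = g @ v @ z"
    then show ?thesis using sgp_eq_append[OF cascade_imp_sgp_eq, of w z u v g "[]"] by simp
  qed (simp add: sgp_eq_refl)
qed

section \<open>Regularity of multiplication\<close>

lemma zip_eq_zipD:
  assumes "zip x y = zip x' y'" "length x = length y" "length x' = length y'"
  shows "x = x'" "y = y'"
  using assms by (metis map_fst_zip, metis map_snd_zip)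

lemma fin_index_avoids: "fin_index {w. avoids u w}"
proof -
  have "{w. avoids u w} = - lconc UNIV (lconc {u} UNIV)"
    by (auto simp: avoids_def lconc_def)
  then show ?thesis
    by (simp add: fin_index_Compl fin_index_lconc fin_index_singleton)
qed

lemma length_cascade:
  assumes "(w, z) \<in> cascade u v" "length u = length v" shows "length w = length z"
  using assms by induction (auto simp: moves_def)

lemma set_cascade: "(w, z) \<in> cascade u v \<Longrightarrow> set w \<subseteq> set u"
  by (induction rule: cascade.induct) (auto simp: moves_def)

text \<open>A move is determined by the length of \<open>p\<close>.\<close>

lemma finite_moves: "finite (moves u v)"
proof (rule finite_subset)
  show "moves u v \<subseteq> (\<lambda>i. (take i u, drop (length u - i) v)) ` {..length u}"
  proof (rule subrelI)
    fix p q assume "(p, q) \<in> moves u v"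
    then obtain s where "u = p @ s" "v = s @ q" by (auto simp: moves_def)
    then show "(p, q) \<in> (\<lambda>i. (take i u, drop (length u - i) v)) ` {..length u}"
      by (intro image_eqI[of _ _ "length p"]) auto
  qed
qed simp

text \<open>Corresponding blocks have equal length, so both tracks split at the same positions and a
  cascade is read as a Kleene star over the moves.\<close>

lemma zip_cascade:
  assumes "length u = length v"
  shows "{zip z w | w z. (w, z) \<in> cascade u v} = lstar ((\<lambda>(p, q). zip q p) ` moves u v)" (is "?C = lstar ?M")
proof (intro set_eqI iffI)
  have len: "length p = length q" if "(p, q) \<in> moves u v" for p q
    using that assms by (auto simp: moves_def)
  {
    fix W assume "W \<in> ?C"
    then obtain w z where W: "W = zip z w" and "(w, z) \<in> cascade u v" by blast
    from this(2) show "W \<in> lstar ?M" unfolding W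
    proof induction
      case cascade_Nil
      show ?case by (simp add: lstar.lstar_Nil)
    next
      case (cascade_move p q w z)
      have "zip q p \<in> ?M" using cascade_move(1) by force
      then show ?case using lstar.lstar_append[OF _ cascade_move.IH] len[OF cascade_move(1)] by simp
    qed
  next
    fix W assume "W \<in> lstar ?M"
    then show "W \<in> ?C"
    proof induction
      case lstar_Nil
      show ?case using cascade.cascade_Nil by force
    next
      case (lstar_append x y)
      obtain p q where "(p, q) \<in> moves u v" "x = zip q p" using lstar_append(1) by auto
      moreover obtain w z where "(w, z) \<in> cascade u v" "y = zip z w" using lstar_append.IH by blast
      ultimately have "x @ y = zip (q @ z) (p @ w)" "(p @ w, q @ z) \<in> cascade u v"
        using len cascade.cascade_move by auto
      then show ?case by blast
    qed
  }
qed

text \<open>Each letter put in front of \<open>z\<close> delays the first track by one position and uses up one of the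
  padding letters \<open>d\<close> at its end.\<close>

lemma fin_index_shifted_cascade:
  assumes len: "length u = length v"
  shows "length v' \<le> length v \<Longrightarrow>
    fin_index {zip (v' @ z @ replicate (length v - length v') d) (w @ u) | w z. (w, z) \<in> cascade u v}"
proof (induction v')
  case Nil
  \<comment> \<open>With nothing in front of \<open>z\<close> the blocks are aligned, and the final
    \<open>u\<close> meets padding only.\<close>
  have "{zip ([] @ z @ replicate (length v - length []) d) (w @ u) | w z. (w, z) \<in> cascade u v}
    = lconc {zip z w | w z. (w, z) \<in> cascade u v} {zip (replicate (length v) d) u}" (is "?L = lconc ?C ?B")
  proof -
    have zip_split: "zip ([] @ z @ replicate (length v - length []) d) (w @ u) = zip z w @ zip (replicate (length v) d) u"
      if "(w, z) \<in> cascade u v" for w z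
      using length_cascade[OF that len] by simp
    show ?thesis
    proof (intro set_eqI iffI)
      fix V assume "V \<in> ?L"
      then obtain w z where "V = zip z w @ zip (replicate (length v) d) u" "(w, z) \<in> cascade u v"
        using zip_split by blast
      then show "V \<in> lconc ?C ?B" unfolding lconc_def by blast
    next
      fix V assume "V \<in> lconc ?C ?B"
      then obtain w z where wz: "V = zip z w @ zip (replicate (length v) d) u" "(w, z) \<in> cascade u v"
        unfolding lconc_def by blast
      then show "V \<in> ?L" using zip_split[OF wz(2)] by (metis (mono_tags, lifting) mem_Collect_eq)
    qed
  qed
  moreover have "fin_index (lconc ?C ?B)" unfolding zip_cascade[OF len]
    by (intro fin_index_lconc fin_index_lstar fin_index_finite finite_imageI finite_moves fin_index_singleton)
  ultimately show ?case by simp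
next
  case (Cons b v')
  define m where "m = length v - Suc (length v')"
  have m: "length v - length v' = Suc m" "length v - length (b # v') = m" using Cons.prems by (auto simp: m_def)
  \<comment> \<open>The language of the induction hypothesis, with one more padding letter, which
    the delay by \<open>b\<close> pushes out.\<close>
  let ?Z = "{zip (v' @ z @ replicate (Suc m) d) (w @ u) | w z. (w, z) \<in> cascade u v}"
  have "?Z \<subseteq> lists (UNIV \<times> set u)"
    using set_cascade by (fastforce dest: set_zip_rightD)
  moreover have "fin_index ?Z" using Cons m by simp
  ultimately have "fin_index {zip (b # X) Y | X Y. length Y = Suc (length X) \<and> zip (X @ [d]) Y \<in> ?Z}"
    by (intro fin_index_delay[of _ "set u"]) simp_all
  moreover have "{zip (b # X) Y | X Y. length Y = Suc (length X) \<and> zip (X @ [d]) Y \<in> ?Z}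
    = {zip ((b # v') @ z @ replicate m d) (w @ u) | w z. (w, z) \<in> cascade u v}" (is "?L = ?R")
  proof (intro set_eqI iffI)
    have len': "length (v' @ z @ replicate (Suc m) d) = length (w @ u)" if "(w, z) \<in> cascade u v" for w z
      using length_cascade[OF that len] len m Cons.prems by simp
    {
      fix V assume "V \<in> ?L"
      then obtain X Y w z where V: "V = zip (b # X) Y" "length Y = Suc (length X)" "(w, z) \<in> cascade u v"
        "zip (X @ [d]) Y = zip (v' @ z @ replicate (Suc m) d) (w @ u)" by blast
      have "X @ [d] = (v' @ z @ replicate m d) @ [d]" "Y = w @ u"
        using zip_eq_zipD[OF V(4)] len'[OF V(3)] V(2) by (simp_all add: replicate_append_same)
      then show "V \<in> ?R" using V(1,3) by auto
    next
      fix V assume "V \<in> ?R"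
      then obtain w z where V: "V = zip ((b # v') @ z @ replicate m d) (w @ u)" "(w, z) \<in> cascade u v" by blast
      have "V = zip (b # (v' @ z @ replicate m d)) (w @ u)" using V by simp
      moreover have "length (w @ u) = Suc (length (v' @ z @ replicate m d))" using len'[OF V(2)] by simp
      moreover have "zip ((v' @ z @ replicate m d) @ [d]) (w @ u) \<in> ?Z"
        using V(2) by (auto simp: replicate_append_same)
      ultimately show "V \<in> ?L" by blast
    }
  qed
  ultimately show ?case using m by simp
qed

text \<open>Once all of \<open>v\<close> stands in front, no padding is left. The tracks are then
  swapped, because the delay acts on the first one.\<close>

lemma fin_index_cascade_pairs:
  assumes len: "length u = length v"
  shows "fin_index {zip (w @ u) (v @ z) | w z. (w, z) \<in> cascade u v}"
proof -
  let ?Z = "{zip (v @ z) (w @ u) | w z. (w, z) \<in> cascade u v}"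
  have "fin_index ?Z" using fin_index_shifted_cascade[OF len, of v] by simp
  then have "fin_index (map prod.swap ` ?Z)" by (rule fin_index_map_image)
  moreover have "map prod.swap (zip x y) = zip y x" for x y :: "'a list"
    by (subst zip_commute) (simp add: prod.swap_def case_prod_unfold)
  then have "map prod.swap ` ?Z = {zip (w @ u) (v @ z) | w z. (w, z) \<in> cascade u v}"
    by (auto simp: image_iff) metis+
  ultimately show ?thesis by simp
qed

text \<open>For \<open>u\<close> and \<open>v\<close> of equal length both tracks have equal length,
  so they can be zipped without padding as long as \<open>a\<close> is kept in the first
  one.\<close>

definition mult_pairs :: "nat list \<Rightarrow> nat list \<Rightarrow> nat list set \<Rightarrow> nat \<Rightarrow> (nat \<times> nat) list set" where
  "mult_pairs u v L a = {zip (\<alpha> @ [a]) \<beta> | \<alpha> \<beta>. \<alpha> \<in> L \<and> \<beta> \<in> L \<and> sgp_eq {(u, v)} (\<alpha> @ [a]) \<beta>}"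

lemma length_sgp_eq:
  assumes "sgp_eq {(u, v)} x y" "length u = length v"
  shows "length x = length y"
  using assms(1) unfolding sgp_eq_def
  by (induction rule: rtrancl_induct) (auto simp: rstep_single assms(2))

lemma fin_index_mult_pairs:
  assumes nf: "unique_nf u v" "moves_left u v" and len: "length u = length v"
    and L: "fin_index L" "\<And>w. w \<in> L \<Longrightarrow> avoids u w"
  shows "fin_index (mult_pairs u v L a)"
proof -
  let ?D = "map (\<lambda>x. (x, x)) ` UNIV" and ?E = "{zip (w @ u) (v @ z) | w z. (w, z) \<in> cascade u v}"
  \<comment> \<open>A rational expression: an unchanged prefix followed by at most one cascade, with
    the first track restricted to \<open>L\<close> times \<open>a\<close> and the second to
    \<open>L\<close>.\<close>
  let ?R = "(?D \<union> lconc ?D ?E) \<inter> ({W. map fst W \<in> lconc L {[a]}} \<inter> {W. map snd W \<in> L})"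
  have diag: "map (\<lambda>x. (x, x)) g = zip g g" for g :: "nat list" by (simp add: zip_same_conv_map)
  have "mult_pairs u v L a = ?R"
  proof (intro set_eqI iffI)
    fix W assume "W \<in> mult_pairs u v L a"
    then obtain \<alpha> \<beta> where W: "W = zip (\<alpha> @ [a]) \<beta>" "\<alpha> \<in> L" "\<beta> \<in> L" "sgp_eq {(u, v)} (\<alpha> @ [a]) \<beta>"
      unfolding mult_pairs_def by blast
    have l: "length (\<alpha> @ [a]) = length \<beta>" using length_sgp_eq[OF W(4) len] .
    have "\<beta> = \<alpha> @ [a] \<or> (\<exists>g w z. (w, z) \<in> cascade u v \<and> \<alpha> @ [a] = g @ w @ u \<and> \<beta> = g @ v @ z)"
      using W right_mult_iff_cascade[OF nf len] L(2) by blast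
    then have "W \<in> ?D \<union> lconc ?D ?E"
    proof (elim disjE exE conjE)
      assume "\<beta> = \<alpha> @ [a]"
      then have "W = map (\<lambda>x. (x, x)) (\<alpha> @ [a])" using W(1) diag by metis
      then show ?thesis by blast
    next
      fix g w z assume "(w, z) \<in> cascade u v" "\<alpha> @ [a] = g @ w @ u" "\<beta> = g @ v @ z"
      then have "W = map (\<lambda>x. (x, x)) g @ zip (w @ u) (v @ z)" "(w, z) \<in> cascade u v"
        using W(1) diag[of g] by simp_all
      then show ?thesis unfolding lconc_def by blast
    qed
    moreover have "map fst W = \<alpha> @ [a]" "map snd W = \<beta>" using W(1) l by simp_all
    ultimately show "W \<in> ?R" using W(2,3) unfolding lconc_def by auto
  next
    fix W assume "W \<in> ?R"
    then obtain \<alpha> \<beta> where W: "map fst W = \<alpha> @ [a]" "map snd W = \<beta>" "\<alpha> \<in> L" "\<beta> \<in> L" "W \<in> ?D \<union> lconc ?D ?E"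
      by (auto simp: lconc_def)
    from W(5) have "\<beta> = \<alpha> @ [a] \<or> (\<exists>g w z. (w, z) \<in> cascade u v \<and> \<alpha> @ [a] = g @ w @ u \<and> \<beta> = g @ v @ z)"
    proof
      assume "W \<in> ?D"
      then have "map fst W = map snd W" by auto
      then show ?thesis using W(1,2) by simp
    next
      assume "W \<in> lconc ?D ?E"
      then obtain g w z where g: "W = map (\<lambda>x. (x, x)) g @ zip (w @ u) (v @ z)" "(w, z) \<in> cascade u v"
        unfolding lconc_def by blast
      have "length (w @ u) = length (v @ z)" using length_cascade[OF g(2) len] len by simp
      then have "map fst W = g @ w @ u" "map snd W = g @ v @ z" using g(1) by (simp_all add: comp_def)
      then show ?thesis using W(1,2) g(2) by auto
    qed
    then have "sgp_eq {(u, v)} (\<alpha> @ [a]) \<beta>" using W(3,4) right_mult_iff_cascade[OF nf len] L(2) by blast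
    moreover have "W = zip (\<alpha> @ [a]) \<beta>" using W(1,2) by (metis zip_map_fst_snd)
    ultimately show "W \<in> mult_pairs u v L a" using W(3,4) unfolding mult_pairs_def by blast
  qed
  moreover have "fin_index ?R"
    by (intro fin_index_Int fin_index_Un fin_index_lconc fin_index_map_image fin_index_map_vimage
        fin_index_UNIV fin_index_cascade_pairs[OF len] fin_index_singleton L(1))
  ultimately show ?thesis by simp
qed

section \<open>Padded multiplication relations\<close>

lemma EQ_letters: "EQ R (\<lambda>x. [x]) \<alpha> \<beta> \<longleftrightarrow> sgp_eq R \<alpha> \<beta>"
  by (simp add: EQ_def phi_def)

lemma padL_eq_rev_padR: "padL \<alpha> \<beta> = rev (padR (rev \<alpha>) (rev \<beta>))"
  by (simp add: padL_def padR_def zip_rev[symmetric] rev_map)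

lemma padR_in_A2:
  assumes "\<alpha> \<in> lists A" "\<beta> \<in> lists A" shows "padR \<alpha> \<beta> \<in> lists (A2 A)"
  using assms by (auto simp: padR_def set_zip nth_append A2_def in_lists_conv_set)

lemma padL_in_A2:
  assumes "\<alpha> \<in> lists A" "\<beta> \<in> lists A" shows "padL \<alpha> \<beta> \<in> lists (A2 A)"
  using padR_in_A2[of "rev \<alpha>" A "rev \<beta>"] assms by (auto simp: padL_eq_rev_padR in_lists_conv_set)

lemma mult_relations_in_A2:
  assumes "L \<subseteq> lists A"
  shows "LR_right R g L a \<subseteq> lists (A2 A)" "LL_right R g L a \<subseteq> lists (A2 A)"
    "LR_left R g L a \<subseteq> lists (A2 A)" "LL_left R g L a \<subseteq> lists (A2 A)"
proof -
  have "padR \<alpha> \<beta> \<in> lists (A2 A) \<and> padL \<alpha> \<beta> \<in> lists (A2 A)" if "\<alpha> \<in> L" "\<beta> \<in> L" for \<alpha> \<beta>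
    using that assms padR_in_A2 padL_in_A2 subsetD by metis
  then show "LR_right R g L a \<subseteq> lists (A2 A)" "LL_right R g L a \<subseteq> lists (A2 A)"
    "LR_left R g L a \<subseteq> lists (A2 A)" "LL_left R g L a \<subseteq> lists (A2 A)"
    unfolding LR_right_def LL_right_def LR_left_def LL_left_def by blast+
qed

lemma padR_Suc: "length \<beta> = Suc (length \<alpha>) \<Longrightarrow> padR \<alpha> \<beta> = zip (map Some \<alpha> @ [None]) (map Some \<beta>)"
  by (simp add: padR_def)

lemma padL_Suc: "length \<beta> = Suc (length \<alpha>) \<Longrightarrow> padL \<alpha> \<beta> = zip (None # map Some \<alpha>) (map Some \<beta>)"
  by (simp add: padL_def)

lemma fin_index_LR_right:
  assumes "fin_index (mult_pairs u v L a)" and len: "length u = length v"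
  shows "fin_index (LR_right {(u, v)} (\<lambda>x. [x]) L [a])"
proof -
  \<comment> \<open>\<open>k\<close> undoes the padding: a missing letter of the first track is read
    as \<open>a\<close>.\<close>
  define k :: "nat option \<times> nat option \<Rightarrow> nat \<times> nat"
    where "k = (\<lambda>(x, y). (case x of None \<Rightarrow> a | Some x \<Rightarrow> x, the y))"
  define h :: "nat \<times> nat \<Rightarrow> nat option \<times> nat option" where "h = map_prod Some Some"
  have h_zip: "map h P = zip (map Some (map fst P)) (map Some (map snd P))" for P
    by (induction P) (auto simp: h_def)
  have kh: "k \<circ> h = id" by (auto simp: k_def h_def)
  \<comment> \<open>The second language puts the padding exactly at the last position of the first
    track, since \<open>k\<close> alone confuses it with a genuine \<open>a\<close>.\<close>
  let ?R = "{V. map k V \<in> mult_pairs u v L a} \<inter> lconc (map h ` UNIV) ((\<lambda>x. [x]) ` ({None} \<times> range Some))"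
  have "LR_right {(u, v)} (\<lambda>x. [x]) L [a] = ?R"
  proof (intro set_eqI iffI)
    fix V assume "V \<in> LR_right {(u, v)} (\<lambda>x. [x]) L [a]"
    then obtain \<alpha> \<beta> where V: "V = padR \<alpha> \<beta>" "\<alpha> \<in> L" "\<beta> \<in> L" "sgp_eq {(u, v)} (\<alpha> @ [a]) \<beta>"
      unfolding LR_right_def EQ_letters by blast
    have l: "length \<beta> = Suc (length \<alpha>)" using length_sgp_eq[OF V(4) len] by simp
    then obtain \<gamma> y where \<beta>: "\<beta> = \<gamma> @ [y]" "length \<gamma> = length \<alpha>" by (cases \<beta> rule: rev_cases) auto
    have V': "V = map h (zip \<alpha> \<gamma>) @ [(None, Some y)]"
      using V(1) \<beta> padR_Suc[OF l] by (simp add: h_def zip_map_map map_prod_def)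
    have "map k V = zip (\<alpha> @ [a]) \<beta>" using \<beta> by (simp add: V' kh) (simp add: k_def)
    then have "map k V \<in> mult_pairs u v L a" using V unfolding mult_pairs_def by blast
    then show "V \<in> ?R" unfolding V' lconc_def by blast
  next
    fix V assume "V \<in> ?R"
    then obtain P y where V: "V = map h P @ [(None, Some y)]" and Z: "map k V \<in> mult_pairs u v L a"
      unfolding lconc_def by blast
    obtain \<alpha> \<beta> where ab: "map k V = zip (\<alpha> @ [a]) \<beta>" "\<alpha> \<in> L" "\<beta> \<in> L" "sgp_eq {(u, v)} (\<alpha> @ [a]) \<beta>"
      using Z unfolding mult_pairs_def by blast
    have l: "length (\<alpha> @ [a]) = length \<beta>" using length_sgp_eq[OF ab(4) len] by simp
    have "map k V = zip (map fst P @ [a]) (map snd P @ [y])"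
      by (simp add: V kh zip_map_fst_snd) (simp add: k_def)
    then have "\<alpha> = map fst P" "\<beta> = map snd P @ [y]"
      using zip_eq_zipD[of "\<alpha> @ [a]" \<beta> "map fst P @ [a]" "map snd P @ [y]"] ab(1) l by simp_all
    then have "V = padR \<alpha> \<beta>"
      using h_zip[of P] by (simp add: padR_Suc V)
    then show "V \<in> LR_right {(u, v)} (\<lambda>x. [x]) L [a]"
      using ab unfolding LR_right_def EQ_letters by blast
  qed
  moreover have "fin_index ?R"
    by (intro fin_index_Int fin_index_lconc fin_index_map_image fin_index_map_vimage
        fin_index_UNIV fin_index_letters assms(1))
  ultimately show ?thesis by simp
qed

text \<open>Left padding is right padding with the first track delayed by one position:
  \<open>None\<close> enters at the front and leaves at the end.\<close>

lemma fin_index_LL_right: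
  assumes "fin_index (LR_right {(u, v)} (\<lambda>x. [x]) L [a])" and len: "length u = length v"
    and A: "finite A" "L \<subseteq> lists A"
  shows "fin_index (LL_right {(u, v)} (\<lambda>x. [x]) L [a])"
proof -
  let ?R = "LR_right {(u, v)} (\<lambda>x. [x]) L [a]"
  have "?R \<subseteq> lists (A2 A)" using A(2) by (rule mult_relations_in_A2)
  also have "\<dots> \<subseteq> lists (UNIV \<times> insert None (Some ` A))" by (intro lists_mono) (auto simp: A2_def)
  finally have "fin_index {zip (None # X) Y | X Y. length Y = Suc (length X) \<and> zip (X @ [None]) Y \<in> ?R}"
    using assms(1) A(1) by (intro fin_index_delay) auto
  moreover have "LL_right {(u, v)} (\<lambda>x. [x]) L [a] =
    {zip (None # X) Y | X Y. length Y = Suc (length X) \<and> zip (X @ [None]) Y \<in> ?R}" (is "_ = ?D")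
  proof (intro set_eqI iffI)
    fix V assume "V \<in> LL_right {(u, v)} (\<lambda>x. [x]) L [a]"
    then obtain \<alpha> \<beta> where V: "V = padL \<alpha> \<beta>" "\<alpha> \<in> L" "\<beta> \<in> L" "sgp_eq {(u, v)} (\<alpha> @ [a]) \<beta>"
      unfolding LL_right_def EQ_letters by blast
    have l: "length \<beta> = Suc (length \<alpha>)" using length_sgp_eq[OF V(4) len] by simp
    have "padR \<alpha> \<beta> \<in> ?R" using V unfolding LR_right_def EQ_letters by blast
    then have "zip (map Some \<alpha> @ [None]) (map Some \<beta>) \<in> ?R" by (simp only: padR_Suc[OF l])
    moreover have "V = zip (None # map Some \<alpha>) (map Some \<beta>)" by (simp only: V(1) padL_Suc[OF l])
    moreover have "length (map Some \<beta>) = Suc (length (map Some \<alpha>))" using l by simp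
    ultimately show "V \<in> ?D" by blast
  next
    fix V assume "V \<in> ?D"
    then obtain X Y where V: "V = zip (None # X) Y" "length Y = Suc (length X)" "zip (X @ [None]) Y \<in> ?R" by blast
    then obtain \<alpha> \<beta> where ab: "zip (X @ [None]) Y = padR \<alpha> \<beta>" "\<alpha> \<in> L" "\<beta> \<in> L" "sgp_eq {(u, v)} (\<alpha> @ [a]) \<beta>"
      unfolding LR_right_def EQ_letters by blast
    have l: "length \<beta> = Suc (length \<alpha>)" using length_sgp_eq[OF ab(4) len] by simp
    have "X = map Some \<alpha>" "Y = map Some \<beta>"
      using zip_eq_zipD[OF ab(1)[unfolded padR_Suc[OF l]]] V(2) l by simp_all
    then have "V = padL \<alpha> \<beta>" by (simp only: V(1) padL_Suc[OF l])
    then show "V \<in> LL_right {(u, v)} (\<lambda>x. [x]) L [a]"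
      using ab unfolding LL_right_def EQ_letters by blast
  qed
  ultimately show ?thesis by simp
qed

section \<open>Left multiplication by reversal\<close>

lemma avoids_rev [simp]: "avoids (rev u) (rev w) \<longleftrightarrow> avoids u w"
proof -
  have "\<not> avoids (rev u) (rev w)" if "\<not> avoids u w" for u w :: "'a list"
  proof -
    obtain x y where "w = x @ u @ y" using \<open>\<not> avoids u w\<close> unfolding avoids_def by blast
    then have "rev w = rev y @ rev u @ rev x" by simp
    then show ?thesis unfolding avoids_def by blast
  qed
  from this[of u w] this[of "rev u" "rev w"] show ?thesis by auto
qed

lemma sgp_eq_rev [simp]: "sgp_eq {(rev u, rev v)} (rev x) (rev y) \<longleftrightarrow> sgp_eq {(u, v)} x y"
proof -
  have rstep_rev: "(rev x, rev y) \<in> rstep {(rev u, rev v)}" if "(x, y) \<in> rstep {(u, v)}" for u v x y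
  proof -
    obtain p q where "x = p @ u @ q" "y = p @ v @ q" using \<open>(x, y) \<in> rstep {(u, v)}\<close> unfolding rstep_single by blast
    then have "rev x = rev q @ rev u @ rev p" "rev y = rev q @ rev v @ rev p" by simp_all
    then show ?thesis unfolding rstep_single by blast
  qed
  have "sgp_eq {(rev u, rev v)} (rev x) (rev y)" if "sgp_eq {(u, v)} x y" for u v x y
    using that unfolding sgp_eq_def
  proof (induction rule: rtrancl_induct)
    case (step y z)
    have "(rev y, rev z) \<in> rstep {(rev u, rev v)} \<union> (rstep {(rev u, rev v)})\<inverse>"
      using step(2) rstep_rev by blast
    then show ?case using step.IH by (rule rtrancl_into_rtrancl[rotated])
  qed simp
  from this[of u v x y] this[of "rev u" "rev v" "rev x" "rev y"] show ?thesis by auto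
qed

lemma unique_nf_rev: "unique_nf u v \<Longrightarrow> unique_nf (rev u) (rev v)"
  unfolding unique_nf_def by (metis avoids_rev rev_rev_ident sgp_eq_rev)

text \<open>Reversal exchanges left with right multiplication and left with right padding.\<close>

lemma LL_left_eq_rev:
  "LL_left {(u, v)} (\<lambda>x. [x]) L [a] = rev ` LR_right {(rev u, rev v)} (\<lambda>x. [x]) (rev ` L) [a]"
proof -
  have "sgp_eq {(rev u, rev v)} (rev \<alpha> @ [a]) (rev \<beta>) \<longleftrightarrow> sgp_eq {(u, v)} ([a] @ \<alpha>) \<beta>" for \<alpha> \<beta>
    using sgp_eq_rev[of u v "[a] @ \<alpha>" \<beta>] by simp
  then have "LR_right {(rev u, rev v)} (\<lambda>x. [x]) (rev ` L) [a] =
    {padR (rev \<alpha>) (rev \<beta>) | \<alpha> \<beta>. \<alpha> \<in> L \<and> \<beta> \<in> L \<and> sgp_eq {(u, v)} ([a] @ \<alpha>) \<beta>}"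
    unfolding LR_right_def EQ_letters by blast
  then show ?thesis unfolding LL_left_def EQ_letters padL_eq_rev_padR by auto
qed

lemma LR_left_eq_rev:
  "LR_left {(u, v)} (\<lambda>x. [x]) L [a] = rev ` LL_right {(rev u, rev v)} (\<lambda>x. [x]) (rev ` L) [a]"
proof -
  have "sgp_eq {(rev u, rev v)} (rev \<alpha> @ [a]) (rev \<beta>) \<longleftrightarrow> sgp_eq {(u, v)} ([a] @ \<alpha>) \<beta>" for \<alpha> \<beta>
    using sgp_eq_rev[of u v "[a] @ \<alpha>" \<beta>] by simp
  then have "LL_right {(rev u, rev v)} (\<lambda>x. [x]) (rev ` L) [a] =
    {padL (rev \<alpha>) (rev \<beta>) | \<alpha> \<beta>. \<alpha> \<in> L \<and> \<beta> \<in> L \<and> sgp_eq {(u, v)} ([a] @ \<alpha>) \<beta>}"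
    unfolding LL_right_def EQ_letters by blast
  moreover have "padR \<alpha> \<beta> = rev (padL (rev \<alpha>) (rev \<beta>))" for \<alpha> \<beta> :: "nat list"
    by (simp add: padL_eq_rev_padR)
  ultimately show ?thesis unfolding LR_left_def EQ_letters by auto
qed

text \<open>Equivalent normal forms coincide, so all four relations are the diagonal.\<close>

lemma mult_relations_Nil:
  assumes "unique_nf u v" "\<And>w. w \<in> L \<Longrightarrow> avoids u w"
  shows "LR_right {(u, v)} (\<lambda>x. [x]) L [] = map (\<lambda>x. (Some x, Some x)) ` L"
    "LL_right {(u, v)} (\<lambda>x. [x]) L [] = map (\<lambda>x. (Some x, Some x)) ` L"
    "LR_left {(u, v)} (\<lambda>x. [x]) L [] = map (\<lambda>x. (Some x, Some x)) ` L"
    "LL_left {(u, v)} (\<lambda>x. [x]) L [] = map (\<lambda>x. (Some x, Some x)) ` L"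
proof -
  have "\<alpha> \<in> L \<and> \<beta> \<in> L \<and> sgp_eq {(u, v)} \<alpha> \<beta> \<longleftrightarrow> \<alpha> \<in> L \<and> \<beta> = \<alpha>" for \<alpha> \<beta>
    using assms sgp_eq_refl unfolding unique_nf_def by metis
  moreover have "padR \<alpha> \<alpha> = map (\<lambda>x. (Some x, Some x)) \<alpha>" "padL \<alpha> \<alpha> = map (\<lambda>x. (Some x, Some x)) \<alpha>" for \<alpha> :: "nat list"
    by (simp_all add: padR_def padL_def zip_map_map zip_same_conv_map)
  ultimately show "LR_right {(u, v)} (\<lambda>x. [x]) L [] = map (\<lambda>x. (Some x, Some x)) ` L"
    "LL_right {(u, v)} (\<lambda>x. [x]) L [] = map (\<lambda>x. (Some x, Some x)) ` L"
    "LR_left {(u, v)} (\<lambda>x. [x]) L [] = map (\<lambda>x. (Some x, Some x)) ` L"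
    "LL_left {(u, v)} (\<lambda>x. [x]) L [] = map (\<lambda>x. (Some x, Some x)) ` L"
    unfolding LR_right_def LL_right_def LR_left_def LL_left_def EQ_letters by auto
qed

section \<open>The automatic structure given by the normal forms\<close>

lemma biautomatic_and_prefix_automatic:
  assumes vu: "deglex_less v u" and len: "length u = length v" and A: "set v \<subseteq> {..<n}"
    and nf: "unique_nf u v" and left: "moves_left u v" "moves_left (rev u) (rev v)"
  shows "biautomatic n {(u, v)} \<and> prefix_automatic n {(u, v)}"
proof -
  define L where "L = {w \<in> lists {..<n}. w \<noteq> [] \<and> avoids u w}"
  let ?g = "\<lambda>x :: nat. [x]" and ?R = "{(u, v)}"
  have L_lists: "L \<subseteq> lists {..<n}" and L_avoids: "\<And>w. w \<in> L \<Longrightarrow> avoids u w" by (auto simp: L_def)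
  have "L = lists {..<n} \<inter> (- {[]} \<inter> {w. avoids u w})" by (auto simp: L_def)
  then have fin: "fin_index L"
    by (simp only: fin_index_Int fin_index_lists fin_index_Compl fin_index_singleton fin_index_avoids)
  have lang: "lang_str n ?R {..<n} ?g L"
    unfolding lang_str_def
  proof (intro conjI allI impI)
    show "regular {..<n} L" using fin L_lists by (rule regular_if_fin_index)
    fix w :: "nat list" assume w: "w \<noteq> [] \<and> set w \<subseteq> {..<n}"
    obtain z where z: "avoids u z" "sgp_eq ?R w z" "set z \<subseteq> {..<n}"
      using ex_nf[OF vu len[symmetric] A, of w] w rtrancl_rstep_imp_sgp_eq by blast
    moreover have "z \<noteq> []" using length_sgp_eq[OF z(2) len] w by auto
    ultimately have "z \<in> L" by (auto simp: L_def)
    moreover have "sgp_eq ?R (phi ?g z) w" using sgp_eq_sym[OF z(2)] by (simp add: phi_def)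
    ultimately show "\<exists>\<alpha>\<in>L. sgp_eq ?R (phi ?g \<alpha>) w" by blast
  qed (auto simp: L_def)
  have right: "fin_index (LR_right {(u, v)} ?g L [a]) \<and> fin_index (LL_right {(u, v)} ?g L [a])"
    if "unique_nf u v" "moves_left u v" "length u = length v" "fin_index L" "\<And>w. w \<in> L \<Longrightarrow> avoids u w" "L \<subseteq> lists {..<n}"
    for u v L a
    using fin_index_LR_right[OF fin_index_mult_pairs[OF that(1-5)]] fin_index_LL_right[OF _ that(3) _ that(6)] that(3)
    by blast
  \<comment> \<open>The reversed rule and the reversed language satisfy the same assumptions; this
    will yield multiplication on the left.\<close>
  have rev_right: "fin_index (LR_right {(rev u, rev v)} ?g (rev ` L) [a]) \<and> fin_index (LL_right {(rev u, rev v)} ?g (rev ` L) [a])" for a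
  proof (rule right)
    show "unique_nf (rev u) (rev v)" using nf by (rule unique_nf_rev)
    show "fin_index (rev ` L)" using fin by (rule fin_index_rev)
    show "rev ` L \<subseteq> lists {..<n}" using L_lists by (auto simp: in_lists_conv_set)
  qed (use left len L_avoids in auto)
  have all: "fin_index (LR_right ?R ?g L a)" "fin_index (LL_right ?R ?g L a)"
    "fin_index (LR_left ?R ?g L a)" "fin_index (LL_left ?R ?g L a)" if a: "a \<in> letters_eps {..<n}" for a
  proof -
    consider "a = []" | x where "a = [x]" using a unfolding letters_eps_def by blast
    then have "fin_index (LR_right ?R ?g L a) \<and> fin_index (LL_right ?R ?g L a) \<and>
      fin_index (LR_left ?R ?g L a) \<and> fin_index (LL_left ?R ?g L a)"
    proof cases
      case 1
      then show ?thesis using mult_relations_Nil[OF nf L_avoids] fin_index_map_image[OF fin] by simp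
    next
      case 2
      then show ?thesis
        unfolding 2 LL_left_eq_rev LR_left_eq_rev
        using right[OF nf left(1) len fin L_avoids L_lists, of x] rev_right[of x] by (blast intro: fin_index_rev)
    qed
    then show "fin_index (LR_right ?R ?g L a)" "fin_index (LL_right ?R ?g L a)"
      "fin_index (LR_left ?R ?g L a)" "fin_index (LL_left ?R ?g L a)" by blast+
  qed
  have regular: "regular (A2 {..<n}) (LR_right ?R ?g L a)" "regular (A2 {..<n}) (LL_right ?R ?g L a)"
    "regular (A2 {..<n}) (LR_left ?R ?g L a)" "regular (A2 {..<n}) (LL_left ?R ?g L a)"
    if "a \<in> letters_eps {..<n}" for a
    using all[OF that] mult_relations_in_A2[OF L_lists, of ?R ?g a] regular_if_fin_index by blast+
  have "biautomatic n ?R" unfolding biautomatic_def using lang regular by blast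
  moreover have "prefix_automatic n ?R"
  proof -
    \<comment> \<open>Nonempty prefixes of normal forms are normal forms, so the prefix relation is
      the one for the empty word.\<close>
    have "\<beta> \<in> L" if "\<beta> \<noteq> []" "\<beta> @ \<gamma> \<in> L" for \<beta> \<gamma>
      using that avoids_factor[of u "[]" \<beta> \<gamma>] by (auto simp: L_def)
    moreover have "\<beta> \<noteq> [] \<and> (\<exists>\<gamma>. \<beta> @ \<gamma> \<in> L)" if "\<beta> \<in> L" for \<beta>
      using that by (auto simp: L_def intro!: exI[of _ "[]"])
    ultimately have pref: "\<beta> \<noteq> [] \<and> (\<exists>\<gamma>. \<beta> @ \<gamma> \<in> L) \<longleftrightarrow> \<beta> \<in> L" for \<beta> by blast
    have "{padR \<alpha> \<beta> | \<alpha> \<beta>. \<alpha> \<in> L \<and> \<beta> \<noteq> [] \<and> (\<exists>\<gamma>. \<beta> @ \<gamma> \<in> L) \<and> EQ ?R ?g \<alpha> \<beta>} = LR_right ?R ?g L []"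
      unfolding LR_right_def append_Nil2 using pref by (metis (no_types, lifting))
    moreover have "regular (A2 {..<n}) (LR_right ?R ?g L [])" by (rule regular) (simp add: letters_eps_def)
    ultimately have "regular (A2 {..<n}) {padR \<alpha> \<beta> | \<alpha> \<beta>. \<alpha> \<in> L \<and> \<beta> \<noteq> [] \<and> (\<exists>\<gamma>. \<beta> @ \<gamma> \<in> L) \<and> EQ ?R ?g \<alpha> \<beta>}"
      by (simp only:)
    moreover have "automatic_str n ?R {..<n} ?g L" unfolding automatic_str_def using lang regular by blast
    ultimately show ?thesis unfolding prefix_automatic_def by (intro exI conjI)
  qed
  ultimately show ?thesis by blast
qed

section \<open>Checking the conditions of the theorem\<close>

text \<open>The overlap \<open>aaa\<close> of the rule \<open>aa \<rightarrow> cd\<close> reduces to both \<open>cda\<close> and \<open>acd\<close>,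
  which never have the same normal form.\<close>

lemma unique_nf_square_imp_eq:
  assumes nf: "unique_nf [a, a] [c, d]"
  shows "c = a \<and> d = a"
proof (rule ccontr)
  assume neq: "\<not> (c = a \<and> d = a)"
  have av: "avoids [a, a] [p, q, r] \<longleftrightarrow> \<not> (p = a \<and> q = a) \<and> \<not> (q = a \<and> r = a)" for p q r
    by (auto simp: avoids_def Cons_eq_append_conv append_eq_Cons_conv)
  let ?eq = "sgp_eq {([a, a], [c, d])}"
  have left: "?eq [a, a, x] [c, d, x]" and right: "?eq [x, a, a] [x, c, d]" for x
    using sgp_eq_step[of "[a, a]" "[c, d]" "[]" "[x]"] sgp_eq_step[of "[a, a]" "[c, d]" "[x]" "[]"] by simp_all
  have eq: "?eq [c, d, a] [a, c, d]" using sgp_eq_trans[OF sgp_eq_sym[OF left] right] .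
  have uniq: "x = y" if "avoids [a, a] x" "avoids [a, a] y" "?eq x y" for x y
    using nf that unfolding unique_nf_def by blast
  \<comment> \<open>If exactly one of \<open>c\<close> and \<open>d\<close> is \<open>a\<close>, one
    of the two words needs one more step to become irreducible; if neither is, both already are
    irreducible.\<close>
  consider "c = a" "d \<noteq> a" | "c \<noteq> a" "d = a" | "c \<noteq> a" "d \<noteq> a" using neq by blast
  then show False
  proof cases
    case 1
    then have "?eq [a, d, a] [a, d, d]" using sgp_eq_trans[OF eq] left[of d] by simp
    then show False using uniq[of "[a, d, a]" "[a, d, d]"] 1 av by simp
  next
    case 2
    then have "?eq [c, c, a] [a, c, a]" using sgp_eq_trans[OF sgp_eq_sym[OF right[of c]]] eq by simp
    then show False using uniq[of "[c, c, a]" "[a, c, a]"] 2 av by simp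
  next
    case 3
    then show False using uniq[OF _ _ eq] av by simp
  qed
qed

text \<open>An overlap of a suffix of \<open>rev u\<close> with a prefix of \<open>rev v\<close> is
  the reversal of one of a suffix of \<open>v\<close> with a prefix of \<open>u\<close>.\<close>

lemma moves_rev_empty:
  assumes "moves v u = {}" "length u = length v"
  shows "moves (rev u) (rev v) = {}"
proof (rule ccontr)
  assume "moves (rev u) (rev v) \<noteq> {}"
  then obtain p q s where s: "s \<noteq> []" "p \<noteq> []" "rev u = p @ s" "rev v = s @ q" unfolding moves_def by blast
  then have "u = rev s @ rev p" "v = rev q @ rev s" by (metis rev_append rev_rev_ident)+
  moreover have "length p = length q"
    using arg_cong[OF s(3), of length] arg_cong[OF s(4), of length] assms(2) by simp
  then have "q \<noteq> []" using s(2) by auto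
  ultimately have "(rev q, rev p) \<in> moves v u" using s(1) unfolding moves_def by auto
  then show False using assms(1) by blast
qed

theorem theorem3p1p3:
  fixes n k :: nat and u v :: "nat list"
  assumes "k \<ge> 2"
    and "length u = k" and "length v = k"
    and "set u \<subseteq> {..<n}" and "set v \<subseteq> {..<n}"
    and "deglex_less v u"
    and "GS_basis {rel_poly u v :: 'k::field ncpoly}"
    and "(\<forall>t\<ge>1. take t v \<noteq> drop (length u - t) u \<and> drop (length v - t) v \<noteq> take t u)
       \<or> card (set u) = k
       \<or> k = 2
       \<or> \<not> set u \<subseteq> set v
       \<or> (\<forall>w s w' s'. w \<noteq> [] \<and> s \<noteq> [] \<and> set w \<subseteq> {..<n} \<and> set s \<subseteq> {..<n}
             \<and> set w' \<subseteq> {..<n} \<and> set s' \<subseteq> {..<n} \<longrightarrow> u \<noteq> w @ w' @ w \<and> v \<noteq> s @ s' @ s)"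
  shows "biautomatic n {(u, v)} \<and> prefix_automatic n {(u, v)}"
proof -
  have len: "length u = length v" using assms by simp
  have neq: "u \<noteq> v" using assms(6) deglex_irrefl by blast
  have nf: "unique_nf u v" using GS_basis_imp_unique_nf[OF assms(7,6)] len by simp
  have distinct_case: "moves_left u v \<and> moves_left (rev u) (rev v)" if "distinct u"
    using that len neq distinct_imp_unbordered[OF that] distinct_imp_unbordered[of "rev u"]
    by (auto intro!: moves_left_if_unbordered)
  from assms(8) have "moves_left u v \<and> moves_left (rev u) (rev v)"
  proof (elim disjE)
    \<comment> \<open>The first inequality excludes moves of the rule, the second those of the
      reversed rule; \<open>t\<close> is the length of the overlap.\<close>
    assume H: "\<forall>t\<ge>1. take t v \<noteq> drop (length u - t) u \<and> drop (length v - t) v \<noteq> take t u"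
    have "moves u v = {}"
    proof (rule ccontr)
      assume "moves u v \<noteq> {}"
      then obtain p q s where s: "s \<noteq> []" "u = p @ s" "v = s @ q" unfolding moves_def by blast
      then have "take (length s) v = drop (length u - length s) u" by simp
      then show False using H s(1) by (metis One_nat_def Suc_leI length_greater_0_conv)
    qed
    moreover have "moves v u = {}"
    proof (rule ccontr)
      assume "moves v u \<noteq> {}"
      then obtain p q s where s: "s \<noteq> []" "v = p @ s" "u = s @ q" unfolding moves_def by blast
      then have "drop (length v - length s) v = take (length s) u" by simp
      then show False using H s(1) by (metis One_nat_def Suc_leI length_greater_0_conv)
    qed
    ultimately show ?thesis
      using len neq moves_left_if_no_overlap[of u v] moves_left_if_no_overlap[of "rev u" "rev v"]
        moves_rev_empty[of v u] by simp
  next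
    assume "card (set u) = k"
    then have "distinct u" using assms(2) by (simp add: card_distinct)
    then show ?thesis by (rule distinct_case)
  next
    assume "k = 2"
    obtain a b where u: "u = [a, b]" using assms(2) \<open>k = 2\<close> by (auto simp: numeral_2_eq_2 length_Suc_conv)
    obtain c d where v: "v = [c, d]" using assms(3) \<open>k = 2\<close> by (auto simp: numeral_2_eq_2 length_Suc_conv)
    \<comment> \<open>For \<open>a = b\<close> uniqueness would force \<open>v = u\<close>; hence
      \<open>u\<close> has distinct letters.\<close>
    have "a \<noteq> b" using unique_nf_square_imp_eq[of a c d] nf neq u v by auto
    then show ?thesis using distinct_case u by simp
  next
    assume "\<not> set u \<subseteq> set v"
    then show ?thesis using moves_left_if_not_subset[of u v] moves_left_if_not_subset[of "rev u" "rev v"] by simp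
  next
    assume H: "\<forall>w s w' s'. w \<noteq> [] \<and> s \<noteq> [] \<and> set w \<subseteq> {..<n} \<and> set s \<subseteq> {..<n}
             \<and> set w' \<subseteq> {..<n} \<and> set s' \<subseteq> {..<n} \<longrightarrow> u \<noteq> w @ w' @ w \<and> v \<noteq> s @ s' @ s"
    have "unbordered u"
    proof (rule unbordered_if_no_short_border, rule notI)
      fix c m assume c: "c \<noteq> []" "u = c @ m @ c"
      then have "set c \<subseteq> {..<n}" "set m \<subseteq> {..<n}" using assms(4) by auto
      then show False using H c by blast
    qed
    moreover have "unbordered v"
    proof (rule unbordered_if_no_short_border, rule notI)
      fix c m assume c: "c \<noteq> []" "v = c @ m @ c"
      then have "set c \<subseteq> {..<n}" "set m \<subseteq> {..<n}" using assms(5) by auto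
      then show False using H c by blast
    qed
    ultimately show ?thesis using len neq by (simp add: moves_left_if_unbordered unbordered_rev)
  qed
  then show ?thesis using biautomatic_and_prefix_automatic[OF assms(6) len assms(5) nf] by blast
qed

end
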